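(* Let $r$ be an arbitrary natural number and suppose that $f_a:\mathbb{R}^{n\times m}\to\mathbb{R}$ satisfies the $\delta$-RIP$_{2r,2r}$ property. (1) If $\delta\le1/3$, then neither the factorized problem $\min_{U\in\mathbb{R}^{n\times r},V\in\mathbb{R}^{m\times r}}f_a(UV^T)$ nor the regularized problem $\min_{U\in\mathbb{R}^{n\times r},V\in\mathbb{R}^{m\times r}}f_a(UV^T)+\frac{\mu}{4}\|U^TU-V^TV\|_F^2$ (with $\mu>0$) has a spurious second-order critical point. (2) If $\delta\in[0,1/2)$, then every second-order critical point of either problem has a positive correlation with the ground truth $M_a^*$. Namely, there exists a universal function $C:[0,1/2)\to(0,1]$ (depending on nothing but $\delta$) such that for every second-order critical point $(\tilde U,\tilde V)$ of either problem, the matrix $\tilde M=\tilde U\tilde V^T$ satisfies $$\langle\tilde M,M_a^*\rangle\ \ge\ C(\delta)\cdot\|\tilde M\|_F\,\|M_a^*\|_F.$$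
   Context: $f_a$ is twice continuously differentiable. Standing assumption: $f_a$ has a first-order critical point $M_a^*$ (i.e. $\nabla f_a(M_a^* )=0$) with $\mathrm{rank}(M_a^* )\le r$; it is called the ground truth (under the $\delta$-RIP$_{2r,2r}$ property it is the unique global minimizer of $f_a$ over matrices of rank at most $r$). $\delta$-RIP$_{2r,2r}$ (with $\delta\in[0,1)$): $(1-\delta)\|K\|_F^2\le[\nabla^2f_a(M)](K,K)\le(1+\delta)\|K\|_F^2$ for all $M,K\in\mathbb{R}^{n\times m}$ of rank at most $2r$. A second-order critical point of an unconstrained problem is a point where the gradient of the objective vanishes and its Hessian is positive semidefinite; it is spurious if it is not a global minimizer of the problem. $\langle X,Y\rangle=\mathrm{tr}(X^TY)$. *)

theory Defs
  imports
    "HOL-Analysis.Analysis"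
    "HOL-Library.Poly_Mapping"
    "HOL-Library.FuncSet"
    "Jordan_Normal_Form.DL_Rank"
begin

section \<open>A Euclidean coordinate space for matrices of all sizes\<close>

text \<open>
  The function \<open>C\<close> of the main statement must not depend on the dimensions, so these have to be
  quantified inside the formula.  Matrices are therefore taken from \<^typ>\<open>real mat\<close>, with
  explicit carriers.  That type is not a normed space; in order to use the derivatives of the
  library, matrices are identified with their finitely supported families of entries, on which
  we put the inner product \<open>\<Sum>k. x\<^sub>k y\<^sub>k\<close>.
\<close>

instantiation poly_mapping :: (type, real_vector) real_vector
begin

definition scaleR_poly_mapping :: "real \<Rightarrow> ('a, 'b) poly_mapping \<Rightarrow> ('a, 'b) poly_mapping" where
  "scaleR_poly_mapping c = Poly_Mapping.map (scaleR c)"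

lemma lookup_scaleR: "Poly_Mapping.lookup (c *\<^sub>R x) k = c *\<^sub>R Poly_Mapping.lookup x k"
  by (simp add: scaleR_poly_mapping_def map.rep_eq when_def)

instance
  by standard (auto intro!: poly_mapping_eqI
      simp: lookup_scaleR lookup_add scaleR_add_left scaleR_add_right)

end

instantiation poly_mapping :: (type, real_inner) real_inner
begin

definition inner_poly_mapping :: "('a, 'b) poly_mapping \<Rightarrow> ('a, 'b) poly_mapping \<Rightarrow> real" where
  "inner_poly_mapping x y =
    (\<Sum>k\<in>Poly_Mapping.keys x. inner (Poly_Mapping.lookup x k) (Poly_Mapping.lookup y k))"

definition norm_poly_mapping :: "('a, 'b) poly_mapping \<Rightarrow> real" where
  "norm_poly_mapping x = sqrt (inner x x)"

definition sgn_poly_mapping :: "('a, 'b) poly_mapping \<Rightarrow> ('a, 'b) poly_mapping" where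
  "sgn_poly_mapping x = inverse (norm x) *\<^sub>R x"

definition dist_poly_mapping :: "('a, 'b) poly_mapping \<Rightarrow> ('a, 'b) poly_mapping \<Rightarrow> real" where
  "dist_poly_mapping x y = norm (x - y)"

definition uniformity_poly_mapping ::
    "(('a, 'b) poly_mapping \<times> ('a, 'b) poly_mapping) filter" where
  "uniformity_poly_mapping = (INF e\<in>{0<..}. principal {(x, y). dist x y < e})"

definition open_poly_mapping :: "('a, 'b) poly_mapping set \<Rightarrow> bool" where
  "open_poly_mapping U \<longleftrightarrow>
    (\<forall>x\<in>U. \<forall>\<^sub>F (x', y) in uniformity. x' = x \<longrightarrow> y \<in> U)"

lemma inner_poly_mapping_eq:
  fixes x y :: "('a, 'b) poly_mapping"
  assumes "finite S" and "Poly_Mapping.keys x \<inter> Poly_Mapping.keys y \<subseteq> S"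
  shows "inner x y = (\<Sum>k\<in>S. inner (Poly_Mapping.lookup x k) (Poly_Mapping.lookup y k))"
proof -
  have "inner x y =
      (\<Sum>k\<in>Poly_Mapping.keys x \<inter> Poly_Mapping.keys y.
        inner (Poly_Mapping.lookup x k) (Poly_Mapping.lookup y k))"
    unfolding inner_poly_mapping_def
    by (intro sum.mono_neutral_right) (auto simp: in_keys_iff)
  also have "\<dots> = (\<Sum>k\<in>S. inner (Poly_Mapping.lookup x k) (Poly_Mapping.lookup y k))"
    using assms by (intro sum.mono_neutral_left) (auto simp: in_keys_iff)
  finally show ?thesis .
qed

instance
proof
  fix x y z :: "('a, 'b) poly_mapping" and c :: real
  show "sgn x = inverse (norm x) *\<^sub>R x" by (rule sgn_poly_mapping_def)
  show "dist x y = norm (x - y)" by (rule dist_poly_mapping_def)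
  show "uniformity = (INF e\<in>{0<..}. principal {(x, y). dist (x::('a, 'b) poly_mapping) y < e})"
    by (rule uniformity_poly_mapping_def)
  show "open U \<longleftrightarrow> (\<forall>x\<in>U. \<forall>\<^sub>F (x', y) in uniformity. x' = x \<longrightarrow> y \<in> U)"
    for U :: "('a, 'b) poly_mapping set"
    by (rule open_poly_mapping_def)
  show "norm x = sqrt (inner x x)" by (rule norm_poly_mapping_def)
  let ?S = "Poly_Mapping.keys x \<union> Poly_Mapping.keys y \<union> Poly_Mapping.keys z"
  have "inner x y = (\<Sum>k\<in>?S. inner (Poly_Mapping.lookup x k) (Poly_Mapping.lookup y k))"
    "inner y x = (\<Sum>k\<in>?S. inner (Poly_Mapping.lookup y k) (Poly_Mapping.lookup x k))"
    by (intro inner_poly_mapping_eq; auto)+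
  then show "inner x y = inner y x"
    by (simp only: inner_commute)
  have "inner (x + y) z = (\<Sum>k\<in>?S. inner (Poly_Mapping.lookup (x + y) k) (Poly_Mapping.lookup z k))"
    "inner x z = (\<Sum>k\<in>?S. inner (Poly_Mapping.lookup x k) (Poly_Mapping.lookup z k))"
    "inner y z = (\<Sum>k\<in>?S. inner (Poly_Mapping.lookup y k) (Poly_Mapping.lookup z k))"
    by (intro inner_poly_mapping_eq; auto)+
  then show "inner (x + y) z = inner x z + inner y z"
    by (simp only: lookup_add inner_add_left sum.distrib)
  have "inner (c *\<^sub>R x) y = (\<Sum>k\<in>?S. inner (Poly_Mapping.lookup (c *\<^sub>R x) k) (Poly_Mapping.lookup y k))"
    "inner x y = (\<Sum>k\<in>?S. inner (Poly_Mapping.lookup x k) (Poly_Mapping.lookup y k))"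
    by (intro inner_poly_mapping_eq; auto)+
  then show "inner (c *\<^sub>R x) y = c * inner x y"
    by (simp only: lookup_scaleR inner_scaleR_left sum_distrib_left)
  show "0 \<le> inner x x"
    by (simp add: inner_poly_mapping_def sum_nonneg)
  have "inner x x = 0 \<longleftrightarrow> Poly_Mapping.keys x = {}"
    unfolding inner_poly_mapping_def
    by (subst sum_nonneg_eq_0_iff) (auto simp: in_keys_iff simp del: keys_eq_empty)
  then show "inner x x = 0 \<longleftrightarrow> x = 0" by simp
qed

end

type_synonym coords = "(nat \<times> nat, real) poly_mapping"

definition coords_of :: "real mat \<Rightarrow> coords" where
  "coords_of A = Abs_poly_mapping (\<lambda>k. A $$ k when k \<in> {..<dim_row A} \<times> {..<dim_col A})"

definition mat_of :: "nat \<Rightarrow> nat \<Rightarrow> coords \<Rightarrow> real mat" where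
  "mat_of n m x = mat n m (Poly_Mapping.lookup x)"

lemma lookup_coords_of:
  "Poly_Mapping.lookup (coords_of A) k = (A $$ k when k \<in> {..<dim_row A} \<times> {..<dim_col A})"
proof -
  have "finite {k. (A $$ k when k \<in> {..<dim_row A} \<times> {..<dim_col A}) \<noteq> 0}"
    by (rule finite_subset[of _ "{..<dim_row A} \<times> {..<dim_col A}"]) (auto simp: when_def)
  then show ?thesis by (simp add: coords_of_def)
qed

lemma mat_of_coords_of: "A \<in> carrier_mat n m \<Longrightarrow> mat_of n m (coords_of A) = A"
  by (auto simp: mat_of_def lookup_coords_of)


section \<open>Frobenius inner product\<close>

definition mat_trace :: "real mat \<Rightarrow> real" where
  "mat_trace A = (\<Sum>i<dim_row A. A $$ (i, i))"

definition frob_inner :: "real mat \<Rightarrow> real mat \<Rightarrow> real" where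
  "frob_inner X Y = mat_trace (transpose_mat X * Y)"

definition frob_norm :: "real mat \<Rightarrow> real" where
  "frob_norm X = sqrt (frob_inner X X)"

lemma inner_coords_of:
  assumes "A \<in> carrier_mat n m" and "B \<in> carrier_mat n m"
  shows "inner (coords_of A) (coords_of B) = frob_inner A B"
proof -
  have "inner (coords_of A) (coords_of B)
      = (\<Sum>k\<in>{..<n} \<times> {..<m}.
          inner (Poly_Mapping.lookup (coords_of A) k) (Poly_Mapping.lookup (coords_of B) k))"
    using assms by (intro inner_poly_mapping_eq)
        (auto simp: in_keys_iff lookup_coords_of when_def split: if_splits)
  also have "\<dots> = (\<Sum>(i, j)\<in>{..<n} \<times> {..<m}. A $$ (i, j) * B $$ (i, j))"
    using assms by (intro sum.cong) (auto simp: lookup_coords_of)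
  also have "\<dots> = (\<Sum>j<m. \<Sum>i<n. A $$ (i, j) * B $$ (i, j))"
    by (subst sum.swap) (simp add: sum.cartesian_product)
  also have "\<dots> = frob_inner A B"
    using assms by (auto simp: frob_inner_def mat_trace_def scalar_prod_def lessThan_atLeast0
        intro!: sum.cong)
  finally show ?thesis .
qed


section \<open>Gradients, Hessians and critical points\<close>

definition gradient :: "('a::real_inner \<Rightarrow> real) \<Rightarrow> 'a \<Rightarrow> 'a" where
  "gradient f x = (THE D. GDERIV f x :> D)"

lemma gradient_eqI:
  assumes "GDERIV f x :> D"
  shows "gradient f x = D"
  unfolding gradient_def
proof (rule the_equality)
  show "GDERIV f x :> D" by (fact assms)
next
  fix D' assume "GDERIV f x :> D'"
  then have "(\<lambda>h. inner h D') = (\<lambda>h. inner h D)"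
    using assms unfolding gderiv_def by (rule has_derivative_unique)
  then show "D' = D"
    by (metis inner_commute vector_eq_ldot)
qed

definition hessian :: "('a::real_inner \<Rightarrow> real) \<Rightarrow> 'a \<Rightarrow> 'a \<Rightarrow> 'a" where
  "hessian f x = frechet_derivative (gradient f) (at x)"

definition twice_cont_diff :: "('a::real_inner \<Rightarrow> real) \<Rightarrow> bool" where
  "twice_cont_diff f \<longleftrightarrow>
    (\<forall>x. \<exists>D. GDERIV f x :> D) \<and>
    (\<forall>x. gradient f differentiable (at x)) \<and>
    continuous_on UNIV (\<lambda>x. Blinfun (hessian f x))"

definition second_order_critical :: "('a::real_inner \<Rightarrow> real) \<Rightarrow> 'a \<Rightarrow> bool" where
  "second_order_critical f x \<longleftrightarrow> gradient f x = 0 \<and> (\<forall>k. 0 \<le> inner (hessian f x k) k)"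

text \<open>
  A function \<open>f\<close> on the \<open>n \<times> m\<close> matrices is differentiated as the function
  \<open>f \<circ> mat_of n m\<close>, which ignores all coordinates outside the \<open>n \<times> m\<close> block: its gradient is
  supported in that block, and its Hessian vanishes in all other directions.
\<close>

definition mat_twice_cont_diff :: "nat \<Rightarrow> nat \<Rightarrow> (real mat \<Rightarrow> real) \<Rightarrow> bool" where
  "mat_twice_cont_diff n m f \<longleftrightarrow> twice_cont_diff (f \<circ> mat_of n m)"

definition mat_gradient :: "nat \<Rightarrow> nat \<Rightarrow> (real mat \<Rightarrow> real) \<Rightarrow> real mat \<Rightarrow> real mat" where
  "mat_gradient n m f M = mat_of n m (gradient (f \<circ> mat_of n m) (coords_of M))"

definition mat_hessian ::
    "nat \<Rightarrow> nat \<Rightarrow> (real mat \<Rightarrow> real) \<Rightarrow> real mat \<Rightarrow> real mat \<Rightarrow> real mat \<Rightarrow> real" where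
  "mat_hessian n m f M K L =
    inner (hessian (f \<circ> mat_of n m) (coords_of M) (coords_of K)) (coords_of L)"

definition pair_second_order_critical ::
    "nat \<Rightarrow> nat \<Rightarrow> nat \<Rightarrow> (real mat \<Rightarrow> real mat \<Rightarrow> real) \<Rightarrow> real mat \<Rightarrow> real mat \<Rightarrow> bool" where
  "pair_second_order_critical n m r h U V \<longleftrightarrow>
    U \<in> carrier_mat n r \<and> V \<in> carrier_mat m r \<and>
    second_order_critical (\<lambda>(x, y). h (mat_of n r x) (mat_of m r y)) (coords_of U, coords_of V)"

definition pair_global_minimizer ::
    "nat \<Rightarrow> nat \<Rightarrow> nat \<Rightarrow> (real mat \<Rightarrow> real mat \<Rightarrow> real) \<Rightarrow> real mat \<Rightarrow> real mat \<Rightarrow> bool" where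
  "pair_global_minimizer n m r h U V \<longleftrightarrow>
    U \<in> carrier_mat n r \<and> V \<in> carrier_mat m r \<and>
    (\<forall>U'\<in>carrier_mat n r. \<forall>V'\<in>carrier_mat m r. h U V \<le> h U' V')"

definition pair_spurious ::
    "nat \<Rightarrow> nat \<Rightarrow> nat \<Rightarrow> (real mat \<Rightarrow> real mat \<Rightarrow> real) \<Rightarrow> real mat \<Rightarrow> real mat \<Rightarrow> bool" where
  "pair_spurious n m r h U V \<longleftrightarrow>
    pair_second_order_critical n m r h U V \<and> \<not> pair_global_minimizer n m r h U V"


section \<open>Low-rank matrix optimization\<close>

text \<open>\<^term>\<open>vec_space.rank n A\<close> is the rank of a matrix \<open>A\<close> with \<open>n\<close> rows.\<close>

definition RIP :: "nat \<Rightarrow> nat \<Rightarrow> nat \<Rightarrow> real \<Rightarrow> (real mat \<Rightarrow> real) \<Rightarrow> bool" where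
  "RIP n m r \<delta> f \<longleftrightarrow> 0 \<le> \<delta> \<and> \<delta> < 1 \<and>
    (\<forall>M\<in>carrier_mat n m. \<forall>K\<in>carrier_mat n m.
      vec_space.rank n M \<le> 2 * r \<longrightarrow> vec_space.rank n K \<le> 2 * r \<longrightarrow>
        (1 - \<delta>) * (frob_norm K)\<^sup>2 \<le> mat_hessian n m f M K K \<and>
        mat_hessian n m f M K K \<le> (1 + \<delta>) * (frob_norm K)\<^sup>2)"

definition ground_truth :: "nat \<Rightarrow> nat \<Rightarrow> nat \<Rightarrow> (real mat \<Rightarrow> real) \<Rightarrow> real mat \<Rightarrow> bool" where
  "ground_truth n m r f M \<longleftrightarrow>
    M \<in> carrier_mat n m \<and> vec_space.rank n M \<le> r \<and> mat_gradient n m f M = 0\<^sub>m n m"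

definition factorized :: "(real mat \<Rightarrow> real) \<Rightarrow> real mat \<Rightarrow> real mat \<Rightarrow> real" where
  "factorized f U V = f (U * transpose_mat V)"

definition regularized :: "(real mat \<Rightarrow> real) \<Rightarrow> real \<Rightarrow> real mat \<Rightarrow> real mat \<Rightarrow> real" where
  "regularized f \<mu> U V = f (U * transpose_mat V) +
    \<mu> / 4 * (frob_norm (transpose_mat U * U - transpose_mat V * V))\<^sup>2"

end

theory Submission
  imports Defs
begin

text \<open>
  Both parts follow from a stronger fact: for \<open>\<delta> < 1/2\<close> every second-order critical point satisfies
  \<open>U V\<^sup>T = M\<^sub>a\<close>, so that \<open>C = 1\<close> works.

  Write \<open>M = U V\<^sup>T\<close>, \<open>E = M\<^sub>a - M\<close> and let \<open>G\<close> be the gradient at \<open>M\<close>; the first-order conditions of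
  the regularized problem force \<open>U\<^sup>T U = V\<^sup>T V\<close>, so in both problems \<open>G V = 0\<close> and \<open>U\<^sup>T G = 0\<close>.  Let
  \<open>P, Q\<close> project onto the column spaces of \<open>U, V\<close> and split \<open>E\<close> into the normal part
  \<open>N = (1 - P) M\<^sub>a (1 - Q)\<close> and the tangential part \<open>T\<close>, of norms \<open>y\<close> and \<open>x\<close>.  The mean value theorem
  and the RIP show that \<open>- G\<close> is \<open>\<delta> |E|\<close>-close to \<open>E\<close> when tested against combinations of \<open>T\<close> and \<open>N\<close>,
  which gives \<open>(g/y - y)\<^sup>2 + x\<^sup>2 \<le> \<delta>\<^sup>2 (x\<^sup>2 + y\<^sup>2)\<close> for \<open>g = - \<langle>G, N\<rangle>\<close>.
  Conversely, factor \<open>M\<^sub>a = Z W\<^sup>T\<close> as close as possible to \<open>(U, V)\<close>.  The optimality condition in the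
  factorization shows that the directions \<open>A = (1 - P) Z\<close>, \<open>B = (1 - Q) W\<close> satisfy
  \<open>|U B\<^sup>T + A V\<^sup>T| \<le> |M\<^sub>a - M|\<close>.  Applying this to \<open>M\<^sub>a\<close> with its normal directions shrunk, the
  second-order condition yields \<open>g \<le> (1 + \<delta>) x y\<close>.  For \<open>\<delta> < 1/2\<close> the two inequalities force \<open>E = 0\<close>.
\<close>

section \<open>The algebra of finitely supported matrices\<close>

text \<open>Product of infinite matrices with finite support. Entries of \<open>x\<close> vanish
  outside the listed columns, so the sum is the full one and no dimensions have to be carried
  along.\<close>

definition mm :: "coords \<Rightarrow> coords \<Rightarrow> coords" (infixl "\<diamond>" 70) where
  "x \<diamond> y = Abs_poly_mapping
    (\<lambda>(i, j). \<Sum>k\<in>snd ` Poly_Mapping.keys x. Poly_Mapping.lookup x (i, k) * Poly_Mapping.lookup y (k, j))"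

definition tp :: "coords \<Rightarrow> coords" where
  "tp x = Poly_Mapping.map_key prod.swap x"

text \<open>Matrices of all sizes share one type; this predicate carries the dimensions that product
  and transpose ignore.\<close>

definition blk :: "nat \<Rightarrow> nat \<Rightarrow> coords \<Rightarrow> bool" where
  "blk n m x \<longleftrightarrow> Poly_Mapping.keys x \<subseteq> {..<n} \<times> {..<m}"

lemma blk_iff: "blk n m x \<longleftrightarrow> (\<forall>i j. \<not> (i < n \<and> j < m) \<longrightarrow> Poly_Mapping.lookup x (i, j) = 0)"
  unfolding blk_def by (auto simp: in_keys_iff subset_iff)

lemma blk_ex: "\<exists>N. blk N N x"
proof -
  let ?K = "fst ` Poly_Mapping.keys x \<union> snd ` Poly_Mapping.keys x"
  have "finite ?K" by simp
  then obtain N where "\<forall>k\<in>?K. k < N" using finite_nat_set_iff_bounded by blast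
  then have "blk N N x" by (force simp: blk_def)
  then show ?thesis ..
qed

lemma blk_mono: "blk n m x \<Longrightarrow> n \<le> n' \<Longrightarrow> m \<le> m' \<Longrightarrow> blk n' m' x"
  unfolding blk_iff by auto

lemma blk_ex2: "\<exists>N. blk N N x \<and> blk N N y"
proof -
  obtain N M where "blk N N x" "blk M M y" using blk_ex by meson
  then have "blk (max N M) (max N M) x \<and> blk (max N M) (max N M) y" by (auto intro: blk_mono)
  then show ?thesis ..
qed

lemma blk_ex3: "\<exists>N. blk N N x \<and> blk N N y \<and> blk N N z"
proof -
  obtain N M where "blk N N x" "blk N N y" "blk M M z" using blk_ex blk_ex2 by meson
  then have "blk (max N M) (max N M) x \<and> blk (max N M) (max N M) y \<and> blk (max N M) (max N M) z"
    by (auto intro: blk_mono)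
  then show ?thesis ..
qed

lemma coords_eqI: "(\<And>i j. Poly_Mapping.lookup x (i, j) = Poly_Mapping.lookup y (i, j)) \<Longrightarrow> x = (y::coords)"
  by (rule poly_mapping_eqI) auto

lemma blk_eqI:
  assumes "blk n m x" "blk n m y"
    "\<And>i j. i < n \<Longrightarrow> j < m \<Longrightarrow> Poly_Mapping.lookup x (i, j) = Poly_Mapping.lookup y (i, j)"
  shows "x = y"
proof (rule coords_eqI)
  fix i j show "Poly_Mapping.lookup x (i, j) = Poly_Mapping.lookup y (i, j)"
    using assms unfolding blk_iff by (cases "i < n \<and> j < m") auto
qed

lemma lookup_tp: "Poly_Mapping.lookup (tp x) (i, j) = Poly_Mapping.lookup x (j, i)"
  unfolding tp_def by (subst map_key.rep_eq) (auto intro: inj_swap)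

lemma lookup_mm_keys:
  "Poly_Mapping.lookup (x \<diamond> y) (i, j) =
    (\<Sum>k\<in>snd ` Poly_Mapping.keys x. Poly_Mapping.lookup x (i, k) * Poly_Mapping.lookup y (k, j))"
proof -
  let ?f = "\<lambda>(i, j). \<Sum>k\<in>snd ` Poly_Mapping.keys x. Poly_Mapping.lookup x (i, k) * Poly_Mapping.lookup y (k, j)"
  have "{k. ?f k \<noteq> 0} \<subseteq> fst ` Poly_Mapping.keys x \<times> snd ` Poly_Mapping.keys y"
  proof clarsimp
    fix i j assume "(\<Sum>k\<in>snd ` Poly_Mapping.keys x. Poly_Mapping.lookup x (i, k) * Poly_Mapping.lookup y (k, j)) \<noteq> 0"
    then obtain k where "Poly_Mapping.lookup x (i, k) * Poly_Mapping.lookup y (k, j) \<noteq> 0"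
      by (meson sum.not_neutral_contains_not_neutral)
    then have "(i, k) \<in> Poly_Mapping.keys x" "(k, j) \<in> Poly_Mapping.keys y"
      by (auto simp: in_keys_iff)
    then show "i \<in> fst ` Poly_Mapping.keys x \<and> j \<in> snd ` Poly_Mapping.keys y" by force
  qed
  then have "finite {k. ?f k \<noteq> 0}" by (rule finite_subset) simp
  then show ?thesis unfolding mm_def by (subst lookup_Abs_poly_mapping) auto
qed

lemma lookup_mm:
  assumes "blk N m x"
  shows "Poly_Mapping.lookup (x \<diamond> y) (i, j) =
    (\<Sum>k<m. Poly_Mapping.lookup x (i, k) * Poly_Mapping.lookup y (k, j))"
  unfolding lookup_mm_keys using assms
  by (intro sum.mono_neutral_left) (force simp: blk_def in_keys_iff image_iff)+

lemma lookup_mm':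
  assumes "blk m N y"
  shows "Poly_Mapping.lookup (x \<diamond> y) (i, j) =
    (\<Sum>k<m. Poly_Mapping.lookup x (i, k) * Poly_Mapping.lookup y (k, j))"
proof -
  obtain M where M: "blk M M x" using blk_ex by blast
  have "Poly_Mapping.lookup (x \<diamond> y) (i, j) =
      (\<Sum>k<M. Poly_Mapping.lookup x (i, k) * Poly_Mapping.lookup y (k, j))"
    using lookup_mm[OF M] .
  also have "\<dots> = (\<Sum>k<max m M. Poly_Mapping.lookup x (i, k) * Poly_Mapping.lookup y (k, j))"
    using M by (intro sum.mono_neutral_left) (auto simp: blk_iff)
  also have "\<dots> = (\<Sum>k<m. Poly_Mapping.lookup x (i, k) * Poly_Mapping.lookup y (k, j))"
    using assms by (intro sum.mono_neutral_right) (auto simp: blk_iff)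
  finally show ?thesis .
qed

lemma inner_blk:
  assumes "blk n m x"
  shows "inner x y = (\<Sum>i<n. \<Sum>j<m. Poly_Mapping.lookup x (i, j) * Poly_Mapping.lookup y (i, j))"
proof -
  have "inner x y = (\<Sum>k\<in>{..<n} \<times> {..<m}. inner (Poly_Mapping.lookup x k) (Poly_Mapping.lookup y k))"
    using assms by (intro inner_poly_mapping_eq) (auto simp: blk_def)
  then show ?thesis by (simp add: sum.cartesian_product case_prod_unfold)
qed

section \<open>Closure of blocks and the laws of product and transpose\<close>

lemma blk_zero [simp]: "blk n m 0" by (simp add: blk_def)
lemma blk_add: "blk n m x \<Longrightarrow> blk n m y \<Longrightarrow> blk n m (x + y)"
  by (auto simp: blk_iff lookup_add)
lemma blk_diff: "blk n m x \<Longrightarrow> blk n m y \<Longrightarrow> blk n m (x - y)"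
  by (auto simp: blk_iff lookup_minus)
lemma blk_minus: "blk n m x \<Longrightarrow> blk n m (- x)"
  by (auto simp: blk_iff)
lemma blk_scaleR: "blk n m x \<Longrightarrow> blk n m (c *\<^sub>R x)"
  by (auto simp: blk_iff lookup_scaleR)
lemma blk_tp: "blk n m x \<Longrightarrow> blk m n (tp x)"
  by (auto simp: blk_iff lookup_tp)
lemma blk_mm: "blk n k x \<Longrightarrow> blk k' m y \<Longrightarrow> blk n m (x \<diamond> y)"
  unfolding blk_iff[of n m] by (auto simp: lookup_mm blk_iff)

lemmas blk_intros = blk_add blk_diff blk_minus blk_scaleR blk_tp blk_mm

lemma tp_tp [simp]: "tp (tp x) = x"
  by (rule coords_eqI) (simp add: lookup_tp)
lemma tp_zero [simp]: "tp 0 = 0"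
  by (rule coords_eqI) (simp add: lookup_tp)
lemma tp_add: "tp (x + y) = tp x + tp y"
  by (rule coords_eqI) (simp add: lookup_tp lookup_add)
lemma tp_minus: "tp (- x) = - tp x"
  by (rule coords_eqI) (simp add: lookup_tp)
lemma tp_diff: "tp (x - y) = tp x - tp y"
  by (rule coords_eqI) (simp add: lookup_tp lookup_minus)
lemma tp_scaleR: "tp (c *\<^sub>R x) = c *\<^sub>R tp x"
  by (rule coords_eqI) (simp add: lookup_tp lookup_scaleR)
lemma tp_mm: "tp (x \<diamond> y) = tp y \<diamond> tp x"
proof -
  obtain N where "blk N N x" "blk N N y" using blk_ex2 by blast
  then show ?thesis
    by (intro coords_eqI) (simp add: lookup_tp lookup_mm[of N N] blk_tp mult.commute)
qed

lemma mm_assoc: "(x \<diamond> y) \<diamond> z = x \<diamond> (y \<diamond> z)"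
proof -
  obtain N where N: "blk N N x" "blk N N y" "blk N N z" using blk_ex3 by blast
  show ?thesis
  proof (rule coords_eqI)
    fix i j
    have "Poly_Mapping.lookup ((x \<diamond> y) \<diamond> z) (i, j) = (\<Sum>k<N. \<Sum>l<N.
        Poly_Mapping.lookup x (i, l) * Poly_Mapping.lookup y (l, k) * Poly_Mapping.lookup z (k, j))"
      using N by (simp add: lookup_mm[of N N] blk_mm sum_distrib_right)
    also have "\<dots> = (\<Sum>l<N. \<Sum>k<N.
        Poly_Mapping.lookup x (i, l) * Poly_Mapping.lookup y (l, k) * Poly_Mapping.lookup z (k, j))"
      by (rule sum.swap)
    also have "\<dots> = Poly_Mapping.lookup (x \<diamond> (y \<diamond> z)) (i, j)"
      using N by (simp add: lookup_mm[of N N] sum_distrib_left mult.assoc)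
    finally show "Poly_Mapping.lookup ((x \<diamond> y) \<diamond> z) (i, j) = Poly_Mapping.lookup (x \<diamond> (y \<diamond> z)) (i, j)" .
  qed
qed

lemma inner_tp: "inner (tp x) y = inner x (tp y)"
proof -
  obtain N where N: "blk N N x" using blk_ex by blast
  show ?thesis
    by (subst inner_blk[OF N], subst inner_blk[OF blk_tp[OF N]], subst sum.swap) (simp add: lookup_tp)
qed

text \<open>Both sides are the triple sum of x_ik y_kj z_ij. This adjointness and its mirror image
  take the place of the cyclic invariance of the trace.\<close>

lemma inner_mm_left: "inner (x \<diamond> y) z = inner y (tp x \<diamond> z)"
proof -
  obtain N where N: "blk N N x" "blk N N y" "blk N N z" using blk_ex3 by blast
  have "inner (x \<diamond> y) z = (\<Sum>i<N. \<Sum>j<N. \<Sum>k<N.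
      Poly_Mapping.lookup x (i, k) * Poly_Mapping.lookup y (k, j) * Poly_Mapping.lookup z (i, j))"
    using N by (simp add: inner_blk[of N N] blk_mm lookup_mm[of N N] sum_distrib_right)
  also have "\<dots> = (\<Sum>i<N. \<Sum>k<N. \<Sum>j<N.
      Poly_Mapping.lookup x (i, k) * Poly_Mapping.lookup y (k, j) * Poly_Mapping.lookup z (i, j))"
    by (rule sum.cong[OF refl], rule sum.swap)
  also have "\<dots> = (\<Sum>k<N. \<Sum>i<N. \<Sum>j<N.
      Poly_Mapping.lookup x (i, k) * Poly_Mapping.lookup y (k, j) * Poly_Mapping.lookup z (i, j))"
    by (rule sum.swap)
  also have "\<dots> = (\<Sum>k<N. \<Sum>j<N. \<Sum>i<N.
      Poly_Mapping.lookup x (i, k) * Poly_Mapping.lookup y (k, j) * Poly_Mapping.lookup z (i, j))"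
    by (rule sum.cong[OF refl], rule sum.swap)
  also have "\<dots> = inner y (tp x \<diamond> z)"
    using N by (simp add: inner_blk[of N N] blk_tp lookup_mm[of N N] lookup_tp sum_distrib_left mult_ac)
  finally show ?thesis .
qed

lemma inner_mm_right: "inner (x \<diamond> y) z = inner x (z \<diamond> tp y)"
proof -
  have "inner (x \<diamond> y) z = inner (tp (tp y \<diamond> tp x)) z" by (simp add: tp_mm)
  also have "\<dots> = inner (tp x) (y \<diamond> tp z)" by (simp only: inner_tp inner_mm_left tp_tp)
  also have "\<dots> = inner x (z \<diamond> tp y)" by (simp add: inner_tp tp_mm)
  finally show ?thesis .
qed

lemma norm_tp [simp]: "norm (tp x) = norm x"
  by (simp add: norm_eq_sqrt_inner inner_tp)

text \<open>Cauchy-Schwarz for each entry, summed over all entries. The bound is independent of the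
  supports, so the product is a bounded bilinear map and can be differentiated.\<close>

lemma norm_mm: "norm (x \<diamond> y) \<le> norm x * norm y"
proof -
  obtain N where N: "blk N N x" "blk N N y" using blk_ex2 by blast
  let ?x = "Poly_Mapping.lookup x" and ?y = "Poly_Mapping.lookup y"
  have "(norm (x \<diamond> y))\<^sup>2 = (\<Sum>i<N. \<Sum>j<N. (\<Sum>k<N. ?x (i, k) * ?y (k, j))\<^sup>2)"
    unfolding power2_norm_eq_inner using N
    by (simp add: inner_blk[of N N] blk_mm lookup_mm[of N N] power2_eq_square)
  also have "\<dots> \<le> (\<Sum>i<N. \<Sum>j<N. (\<Sum>k<N. (?x (i, k))\<^sup>2) * (\<Sum>k<N. (?y (k, j))\<^sup>2))"
    by (intro sum_mono Cauchy_Schwarz_ineq_sum)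
  also have "\<dots> = (\<Sum>i<N. \<Sum>k<N. (?x (i, k))\<^sup>2) * (\<Sum>j<N. \<Sum>k<N. (?y (k, j))\<^sup>2)"
    by (simp add: sum_product)
  also have "(\<Sum>j<N. \<Sum>k<N. (?y (k, j))\<^sup>2) = (\<Sum>k<N. \<Sum>j<N. (?y (k, j))\<^sup>2)"
    by (rule sum.swap)
  also have "(\<Sum>i<N. \<Sum>k<N. (?x (i, k))\<^sup>2) * \<dots> = (norm x * norm y)\<^sup>2"
    unfolding power_mult_distrib power2_norm_eq_inner using N
    by (simp add: inner_blk[of N N] power2_eq_square)
  finally show ?thesis by (rule power2_le_imp_le) simp
qed

interpretation mm: bounded_bilinear "(\<diamond>)"
proof
  fix x x' y y' :: coords and c :: real
  show "(x + x') \<diamond> y = x \<diamond> y + x' \<diamond> y"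
  proof -
    obtain N where N: "blk N N x" "blk N N x'" using blk_ex2 by blast
    then show ?thesis
      by (intro coords_eqI) (simp add: lookup_add lookup_mm[of N N] blk_add algebra_simps sum.distrib)
  qed
  obtain N where N: "blk N N x" using blk_ex by blast
  show "x \<diamond> (y + y') = x \<diamond> y + x \<diamond> y'"
    using N by (intro coords_eqI) (simp add: lookup_add lookup_mm[of N N] algebra_simps sum.distrib)
  show "(c *\<^sub>R x) \<diamond> y = c *\<^sub>R (x \<diamond> y)"
    using N by (intro coords_eqI) (simp add: lookup_scaleR lookup_mm[of N N] blk_scaleR sum_distrib_left mult_ac)
  show "x \<diamond> (c *\<^sub>R y) = c *\<^sub>R (x \<diamond> y)"
    using N by (intro coords_eqI) (simp add: lookup_scaleR lookup_mm[of N N] sum_distrib_left mult_ac)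
  show "\<exists>K. \<forall>x y. norm (x \<diamond> y) \<le> norm x * norm y * K"
    using norm_mm by (intro exI[of _ 1]) simp
qed

lemma bounded_linear_tp: "bounded_linear tp"
  by (rule bounded_linear_intro[of _ 1]) (simp_all add: tp_add tp_scaleR)

lemmas mm_simps = mm.add_left mm.add_right mm.diff_left mm.diff_right mm.minus_left mm.minus_right
  mm.scaleR_left mm.scaleR_right mm.zero_left mm.zero_right mm_assoc tp_mm tp_add tp_diff tp_scaleR

text \<open>The orthogonal projection onto the n x m block. It translates functions of
  \<open>mat_of n m x\<close> into functions on \<open>coords\<close>.\<close>

definition pr :: "nat \<Rightarrow> nat \<Rightarrow> coords \<Rightarrow> coords" where
  "pr n m x = coords_of (mat_of n m x)"

lemma lookup_pr: "Poly_Mapping.lookup (pr n m x) (i, j) = (if i < n \<and> j < m then Poly_Mapping.lookup x (i, j) else 0)"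
  by (auto simp: pr_def lookup_coords_of mat_of_def when_def)

lemma blk_pr [simp]: "blk n m (pr n m x)"
  by (auto simp: blk_iff lookup_pr)
lemma pr_blk [simp]: "blk n m x \<Longrightarrow> pr n m x = x"
  by (auto intro!: coords_eqI simp: blk_iff lookup_pr)
lemma inner_pr: "inner (pr n m x) y = inner x (pr n m y)"
proof -
  have "inner (pr n m x) y = (\<Sum>i<n. \<Sum>j<m. Poly_Mapping.lookup x (i, j) * Poly_Mapping.lookup y (i, j))"
    by (simp add: inner_blk[OF blk_pr] lookup_pr)
  moreover have "inner (pr n m y) x = (\<Sum>i<n. \<Sum>j<m. Poly_Mapping.lookup x (i, j) * Poly_Mapping.lookup y (i, j))"
    by (simp add: inner_blk[OF blk_pr] lookup_pr mult.commute)
  ultimately show ?thesis by (simp add: inner_commute)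
qed
lemma norm_pr: "norm (pr n m x) \<le> norm x"
proof -
  have "(norm (pr n m x))\<^sup>2 = inner (pr n m x) x"
    by (metis power2_norm_eq_inner blk_pr inner_commute inner_pr pr_blk)
  also have "\<dots> \<le> norm (pr n m x) * norm x" by (rule norm_cauchy_schwarz)
  finally show ?thesis
    by (cases "norm (pr n m x) = 0") (auto simp: power2_eq_square)
qed

lemma bounded_linear_pr: "bounded_linear (pr n m)"
  by (rule bounded_linear_intro[of _ 1])
    (auto intro!: coords_eqI simp: lookup_pr lookup_add lookup_scaleR norm_pr)

section \<open>Translation of matrix operations into coordinates\<close>

lemma blk_coords_of: "A \<in> carrier_mat n m \<Longrightarrow> blk n m (coords_of A)"
  by (auto simp: blk_iff lookup_coords_of when_def)
lemma mat_of_carrier [simp]: "mat_of n m x \<in> carrier_mat n m"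
  by (simp add: mat_of_def)
lemma coords_of_mat_of: "blk n m x \<Longrightarrow> coords_of (mat_of n m x) = x"
  using pr_blk unfolding pr_def .

lemma coords_of_mult:
  assumes "A \<in> carrier_mat n k" "B \<in> carrier_mat k m"
  shows "coords_of (A * B) = coords_of A \<diamond> coords_of B"
proof (rule blk_eqI[of n m])
  show "blk n m (coords_of (A * B))" "blk n m (coords_of A \<diamond> coords_of B)"
    using assms by (auto intro!: blk_coords_of blk_mm)
  fix i j assume "i < n" "j < m"
  then show "Poly_Mapping.lookup (coords_of (A * B)) (i, j) = Poly_Mapping.lookup (coords_of A \<diamond> coords_of B) (i, j)"
    using assms by (simp add: lookup_mm[OF blk_coords_of[OF assms(1)]] lookup_coords_of
        scalar_prod_def lessThan_atLeast0)
qed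

lemma coords_of_transpose: "coords_of (transpose_mat A) = tp (coords_of A)"
  by (rule coords_eqI) (auto simp: lookup_tp lookup_coords_of when_def)

lemma coords_of_minus: "A \<in> carrier_mat n m \<Longrightarrow> B \<in> carrier_mat n m \<Longrightarrow> coords_of (A - B) = coords_of A - coords_of B"
  by (rule coords_eqI) (auto simp: lookup_minus lookup_coords_of when_def)

section \<open>Identity blocks and inverses\<close>

definition un :: "nat \<Rightarrow> coords" where "un r = coords_of (1\<^sub>m r)"

lemma lookup_un: "Poly_Mapping.lookup (un r) (i, j) = (if i = j \<and> i < r then 1 else 0)"
  by (auto simp: un_def lookup_coords_of when_def)
lemma blk_un [simp]: "blk r r (un r)"
  by (auto simp: blk_iff lookup_un)
lemma tp_un [simp]: "tp (un r) = un r"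
  by (rule coords_eqI) (auto simp: lookup_tp lookup_un)
lemma mm_un [simp]: "blk n r x \<Longrightarrow> x \<diamond> un r = x"
  by (rule coords_eqI) (auto simp: lookup_mm[of n r] lookup_un blk_iff if_distrib cong: if_cong)
lemma un_mm [simp]: "blk r n x \<Longrightarrow> un r \<diamond> x = x"
  by (metis blk_tp mm_un tp_mm tp_tp tp_un)

lemma square_inverse_commute:
  assumes "blk r r x" "blk r r y" "x \<diamond> y = un r"
  shows "y \<diamond> x = un r"
proof -
  let ?A = "mat_of r r x" and ?B = "mat_of r r y"
  have *: "coords_of (?A * ?B) = x \<diamond> y" "coords_of (?B * ?A) = y \<diamond> x"
    using assms by (simp_all add: coords_of_mult[of _ r r _ r] coords_of_mat_of)
  have "?A * ?B = mat_of r r (coords_of (?A * ?B))"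
    by (rule mat_of_coords_of[symmetric]) (meson mat_of_carrier mult_carrier_mat)
  also have "\<dots> = mat_of r r (coords_of (1\<^sub>m r))" using * assms(3) by (simp add: un_def)
  also have "\<dots> = 1\<^sub>m r" by (rule mat_of_coords_of) simp
  finally have "?B * ?A = 1\<^sub>m r" by (intro mat_mult_left_right_inverse[of ?A r ?B]) auto
  then show ?thesis using * by (simp add: un_def)
qed

text \<open>The determinant decides between the two cases. Vectors are encoded as r x 1 blocks, so
  that kernels are handled with the same product.\<close>

lemma square_singular_or_inverse:
  assumes "blk r r x"
  shows "(\<exists>w. blk r 1 w \<and> w \<noteq> 0 \<and> x \<diamond> w = 0) \<or> (\<exists>y. blk r r y \<and> x \<diamond> y = un r \<and> y \<diamond> x = un r)"
proof (cases "det (mat_of r r x) = 0")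
  case True
  then obtain v where v: "v \<in> carrier_vec r" "v \<noteq> 0\<^sub>v r" "mat_of r r x *\<^sub>v v = 0\<^sub>v r"
    using det_0_iff_vec_prod_zero_field[of "mat_of r r x" r] by auto
  let ?w = "coords_of (mat r 1 (\<lambda>(i, j). vec_index v i))"
  have 1: "blk r 1 ?w" by (rule blk_coords_of) simp
  obtain i where i: "i < r" "vec_index v i \<noteq> 0" using v(1,2) by (metis carrier_vecD eq_vecI index_zero_vec)
  then have "Poly_Mapping.lookup ?w (i, 0) \<noteq> 0" by (simp add: lookup_coords_of)
  then have 2: "?w \<noteq> 0" by auto
  have "x \<diamond> ?w = 0"
  proof (rule blk_eqI[of r 1])
    show "blk r 1 (x \<diamond> ?w)" using assms 1 by (rule blk_mm)
    fix i j :: nat assume ij: "i < r" "j < 1"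
    have "0 = vec_index (mat_of r r x *\<^sub>v v) i" using v ij by simp
    also have "\<dots> = Poly_Mapping.lookup (x \<diamond> ?w) (i, j)"
      using ij v(1) by (simp add: lookup_mm[OF assms] mat_of_def lookup_coords_of
          scalar_prod_def lessThan_atLeast0)
    finally show "Poly_Mapping.lookup (x \<diamond> ?w) (i, j) = Poly_Mapping.lookup 0 (i, j)" by simp
  qed simp
  then show ?thesis using 1 2 by blast
next
  case False
  from det_non_zero_imp_unit[OF mat_of_carrier False, of "()"]
  obtain B where B: "B \<in> carrier_mat r r" "B * mat_of r r x = 1\<^sub>m r"
    unfolding Units_def ring_mat_def by auto
  let ?y = "coords_of B"
  have 1: "blk r r ?y" using B(1) by (rule blk_coords_of)
  have 2: "?y \<diamond> x = un r"
    using coords_of_mult[of B r r "mat_of r r x" r] B assms by (simp add: coords_of_mat_of un_def)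
  then have "x \<diamond> ?y = un r" using square_inverse_commute 1 assms by blast
  then show ?thesis using 1 2 by blast
qed

section \<open>Critical factorizations\<close>

lemma abs_lookup_le_norm: "\<bar>Poly_Mapping.lookup x k\<bar> \<le> norm (x :: coords)"
proof -
  have "(Poly_Mapping.lookup x k)\<^sup>2 \<le> (\<Sum>l\<in>insert k (Poly_Mapping.keys x). (Poly_Mapping.lookup x l)\<^sup>2)"
    by (rule member_le_sum) auto
  also have "\<dots> = (norm x)\<^sup>2"
    unfolding power2_norm_eq_inner
    by (subst inner_poly_mapping_eq[of "insert k (Poly_Mapping.keys x)"]) (auto simp: power2_eq_square)
  finally show ?thesis by (simp add: abs_le_square_iff[symmetric])
qed

text \<open>The whole space is infinite-dimensional, so closed bounded sets need not be compact. The
  index set is built up one element at a time: a new coordinate contributes a compact interval, and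
  the larger box is a continuous image of a product.\<close>

lemma compact_box:
  fixes b :: real
  assumes "finite K"
  shows "compact {x :: coords. Poly_Mapping.keys x \<subseteq> K \<and> (\<forall>k. \<bar>Poly_Mapping.lookup x k\<bar> \<le> b)}"
  using assms
proof (induction K)
  case empty
  have "{x :: coords. Poly_Mapping.keys x \<subseteq> {} \<and> (\<forall>k. \<bar>Poly_Mapping.lookup x k\<bar> \<le> b)} \<subseteq> {0}" by auto
  then have "finite {x :: coords. Poly_Mapping.keys x \<subseteq> {} \<and> (\<forall>k. \<bar>Poly_Mapping.lookup x k\<bar> \<le> b)}"
    by (rule finite_subset) simp
  then show ?case by (rule finite_imp_compact)
next
  case (insert k K)
  let ?S = "\<lambda>K. {x :: coords. Poly_Mapping.keys x \<subseteq> K \<and> (\<forall>k. \<bar>Poly_Mapping.lookup x k\<bar> \<le> b)}"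
  let ?f = "\<lambda>(x :: coords, t :: real). x + t *\<^sub>R Poly_Mapping.single k 1"
  have look: "Poly_Mapping.lookup (x + t *\<^sub>R Poly_Mapping.single k 1) l
      = Poly_Mapping.lookup x l + (if l = k then t else 0)" for x :: coords and t l
    by (simp add: lookup_add lookup_scaleR lookup_single when_def)
  have "?S (insert k K) = ?f ` (?S K \<times> {-b..b})"
  proof (intro equalityI subsetI)
    fix x assume x: "x \<in> ?S (insert k K)"
    let ?t = "Poly_Mapping.lookup x k"
    define y where "y = x + (- ?t) *\<^sub>R Poly_Mapping.single k 1"
    have y: "Poly_Mapping.lookup y l = (if l = k then 0 else Poly_Mapping.lookup x l)" for l
      unfolding y_def look by simp
    have "0 \<le> b" using x abs_ge_zero order_trans by blast
    then have "y \<in> ?S K" using x by (auto simp: y in_keys_iff subset_iff split: if_splits)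
    moreover have "?t \<in> {-b..b}"
    proof -
      have "\<bar>?t\<bar> \<le> b" using x by blast
      then show ?thesis by auto
    qed
    moreover have "x = ?f (y, ?t)" by (simp add: y_def)
    ultimately show "x \<in> ?f ` (?S K \<times> {-b..b})" by (intro image_eqI[of _ _ "(y, ?t)"]) auto
  next
    fix x assume "x \<in> ?f ` (?S K \<times> {-b..b})"
    then obtain y t where y: "y \<in> ?S K" "t \<in> {-b..b}" "x = y + t *\<^sub>R Poly_Mapping.single k 1" by auto
    then have "Poly_Mapping.lookup y k = 0" using insert.hyps by (auto simp: in_keys_iff)
    then show "x \<in> ?S (insert k K)"
      using y by (auto simp: look in_keys_iff subset_iff split: if_splits)
  qed
  moreover have "compact (?f ` (?S K \<times> {-b..b}))"
    by (intro compact_continuous_image compact_Times insert.IH compact_Icc)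
      (auto intro!: continuous_intros simp: case_prod_unfold)
  ultimately show ?case by simp
qed

lemma closed_blk: "closed {x. blk n m x}"
proof -
  have "{x. blk n m x} = {x. pr n m x = x}" by (auto intro: pr_blk) (metis blk_pr)
  then show ?thesis
    by (simp add: closed_Collect_eq linear_continuous_on bounded_linear_pr)
qed

lemma compact_blk: "compact {x. blk n m x \<and> norm x \<le> b}"
proof -
  have "{x. blk n m x \<and> norm x \<le> b} = {x :: coords. Poly_Mapping.keys x \<subseteq> {..<n} \<times> {..<m} \<and>
      (\<forall>k. \<bar>Poly_Mapping.lookup x k\<bar> \<le> b)} \<inter> {x. norm x \<le> b}"
    using order_trans[OF abs_lookup_le_norm] unfolding blk_def by blast
  moreover have "closed {x :: coords. norm x \<le> b}" by (intro closed_Collect_le continuous_intros)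
  ultimately show ?thesis
    by (simp only: compact_Int_closed compact_box finite_cartesian_product finite_lessThan)
qed

text \<open>Only points at least as close as some fixed \<open>c0\<close> in \<open>C\<close>
  compete. They form a compact set, since both components are bounded and supported in fixed blocks,
  and the distance is continuous.\<close>

lemma nearest_pair:
  assumes C: "closed C" "C \<noteq> {}" "\<And>z w. (z, w) \<in> C \<Longrightarrow> blk n r z \<and> blk m s w"
  obtains z w where "(z, w) \<in> C"
    "\<And>z' w'. (z', w') \<in> C \<Longrightarrow> (norm (z - u))\<^sup>2 + (norm (w - v))\<^sup>2 \<le> (norm (z' - u))\<^sup>2 + (norm (w' - v))\<^sup>2"
proof -
  define f where "f = (\<lambda>(z, w). (norm (z - u))\<^sup>2 + (norm (w - v :: coords))\<^sup>2)"
  have cont: "continuous_on A f" for A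
    unfolding f_def by (auto intro!: continuous_intros simp: case_prod_unfold)
  obtain c0 where c0: "c0 \<in> C" using C(2) by blast
  \<comment> \<open>A competitor differs from \<open>u\<close> and \<open>v\<close> by at most
    \<open>sqrt (f c0)\<close> in each component; this one radius serves both components.\<close>
  define b where "b = norm u + norm v + sqrt (f c0)"
  define D where "D = ({z. blk n r z \<and> norm z \<le> b} \<times> {w. blk m s w \<and> norm w \<le> b}) \<inter> (C \<inter> {p. f p \<le> f c0})"
  have "compact D" unfolding D_def
    by (intro compact_Int_closed compact_Times compact_blk closed_Int C(1) closed_Collect_le cont continuous_on_const)
  have inD: "(z, w) \<in> D" if "(z, w) \<in> C" "f (z, w) \<le> f c0" for z w
  proof -
    have fzw: "f (z, w) = (norm (z - u))\<^sup>2 + (norm (w - v))\<^sup>2" by (simp add: f_def)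
    have "(norm (z - u))\<^sup>2 \<le> f c0" "(norm (w - v))\<^sup>2 \<le> f c0"
      using that(2) zero_le_power2[of "norm (z - u)"] zero_le_power2[of "norm (w - v)"] fzw
      by linarith+
    then have "norm (z - u) \<le> sqrt (f c0)" "norm (w - v) \<le> sqrt (f c0)"
      by (auto intro: real_le_rsqrt)
    then have "norm z \<le> b" "norm w \<le> b" unfolding b_def
      using norm_triangle_sub[of z u] norm_triangle_sub[of w v] norm_ge_zero[of u] norm_ge_zero[of v]
      by linarith+
    then show ?thesis using that C(3) by (auto simp: D_def)
  qed
  have "c0 \<in> D" using inD[of "fst c0" "snd c0"] c0 by simp
  then have "D \<noteq> {}" by blast
  from continuous_attains_inf[OF \<open>compact D\<close> this cont]
  obtain c where c: "c \<in> D" "\<And>d. d \<in> D \<Longrightarrow> f c \<le> f d" by blast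
  have "f c \<le> f d" if "d \<in> C" for d
  proof (cases "f d \<le> f c0")
    case True
    then show ?thesis using inD[of "fst d" "snd d"] that c(2) by simp
  next
    case False
    then show ?thesis using c(1) by (auto simp: D_def)
  qed
  then show ?thesis using c(1) that[of "fst c" "snd c"] unfolding D_def f_def by (auto simp: case_prod_unfold)
qed

text \<open>Replacing (Z, W) by (Z S, W S^{-T}) does not change Z W^T. At the factorization nearest
  to (U, V) the derivative of the distance along S = 1 + e X vanishes for every X, which is the last
  identity. With U = V = 0 it yields a balanced factorization.\<close>

lemma factorization_critical:
  assumes blk: "blk n r U" "blk m r V" "blk n r Z0" "blk m r W0"
  obtains Z W where "blk n r Z" "blk m r W" "Z \<diamond> tp W = Z0 \<diamond> tp W0"
    "tp Z \<diamond> Z - tp Z \<diamond> U = tp W \<diamond> W - tp V \<diamond> W"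
proof -
  define C where "C = {p. blk n r (fst p) \<and> blk m r (snd p) \<and> fst p \<diamond> tp (snd p) = Z0 \<diamond> tp W0}"
  have "closed C"
  proof -
    have "C = {z. blk n r z} \<times> {w. blk m r w} \<inter> {p. fst p \<diamond> tp (snd p) = Z0 \<diamond> tp W0}"
      by (auto simp: C_def)
    moreover have "closed {p. fst p \<diamond> tp (snd p) = Z0 \<diamond> tp W0}"
      by (intro closed_Collect_eq mm.continuous_on bounded_linear.continuous_on[OF bounded_linear_tp]
          continuous_intros)
    ultimately show ?thesis by (simp add: closed_Int closed_Times closed_blk)
  qed
  moreover have "C \<noteq> {}" using blk by (auto simp: C_def)
  ultimately obtain Z W where ZW: "(Z, W) \<in> C" and
    min: "\<And>z w. (z, w) \<in> C \<Longrightarrow> (norm (Z - U))\<^sup>2 + (norm (W - V))\<^sup>2 \<le> (norm (z - U))\<^sup>2 + (norm (w - V))\<^sup>2"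
    by (rule nearest_pair[of C n r m r]) (auto simp: C_def)
  have Z: "blk n r Z" and W: "blk m r W" and XZW: "Z \<diamond> tp W = Z0 \<diamond> tp W0" using ZW by (auto simp: C_def)
  let ?D = "(tp Z \<diamond> Z - tp Z \<diamond> U) - (tp W \<diamond> W - tp V \<diamond> W)"
  have "?D = 0"
  proof (rule blk_eqI[of r r])
    show "blk r r ?D" using Z W blk by (auto intro!: blk_intros)
    fix i j assume ij: "i < r" "j < r"
    \<comment> \<open>A matrix unit: pairing with it reads off the entry (i, j) of
      \<open>?D\<close>. Its square is X or 0, which makes the inverse of 1 + e X explicit.\<close>
    define X :: coords where "X = Poly_Mapping.single (i, j) 1"
    have X: "blk r r X" using ij by (auto simp: X_def blk_def)
    define c :: real where "c = (if i = j then 1 else 0)"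
    have XX: "X \<diamond> X = c *\<^sub>R X"
    proof (rule coords_eqI)
      fix a b
      have lX: "Poly_Mapping.lookup X (a, b) = (if a = i \<and> b = j then 1 else 0)" for a b
        by (auto simp: X_def lookup_single when_def)
      have "Poly_Mapping.lookup (X \<diamond> X) (a, b) = (\<Sum>k<r. if k = j then (if a = i \<and> j = i \<and> b = j then 1 else 0) else 0)"
        unfolding lookup_mm[OF X] by (rule sum.cong) (auto simp: lX)
      then show "Poly_Mapping.lookup (X \<diamond> X) (a, b) = Poly_Mapping.lookup (c *\<^sub>R X) (a, b)"
        using ij by (simp add: lookup_scaleR c_def lX)
    qed
    \<comment> \<open>since \<open>X \<diamond> X = c *\<^sub>R X\<close>, the inverse of \<open>1 + e *\<^sub>R X\<close> is \<open>1 - h e *\<^sub>R X\<close>\<close>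
    define h where "h = (\<lambda>e. e / (1 + c * e))"
    define a where "a = inner (Z - U) (Z \<diamond> X)"
    define b where "b = inner (W - V) (W \<diamond> tp X)"
    \<comment> \<open>The squared distance to (U, V) along the curve of factorizations; the bound
      1/2 on |e| below keeps 1 + c e away from zero.\<close>
    define g where "g = (\<lambda>e. (norm (Z - U))\<^sup>2 + 2 * e * a + e\<^sup>2 * (norm (Z \<diamond> X))\<^sup>2
        + (norm (W - V))\<^sup>2 - 2 * h e * b + (h e)\<^sup>2 * (norm (W \<diamond> tp X))\<^sup>2)"
    have "g 0 \<le> g e" if e: "\<bar>e\<bar> < 1/2" for e
    proof -
      let ?z = "Z + e *\<^sub>R (Z \<diamond> X)" and ?w = "W - h e *\<^sub>R (W \<diamond> tp X)"
      have ne: "1 + c * e \<noteq> 0" using e by (auto simp: c_def)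
      have "e - h e - h e * (e * c) = 0" using ne by (simp add: h_def field_simps)
      then have "(e - h e - h e * (e * c)) *\<^sub>R (Z \<diamond> (X \<diamond> tp W)) = 0" by simp
      moreover have "X \<diamond> (X \<diamond> tp W) = c *\<^sub>R (X \<diamond> tp W)" 
        by (metis XX mm_assoc mm.scaleR_left)
      ultimately have "?z \<diamond> tp ?w = Z \<diamond> tp W"
        by (simp add: mm_simps algebra_simps)
      then have "(?z, ?w) \<in> C" using Z W X XZW by (auto simp: C_def intro!: blk_intros)
      from min[OF this] have "(norm (Z - U))\<^sup>2 + (norm (W - V))\<^sup>2 \<le> (norm (?z - U))\<^sup>2 + (norm (?w - V))\<^sup>2" .
      also have "?z - U = (Z - U) + e *\<^sub>R (Z \<diamond> X)" by simp
      also have "?w - V = (W - V) - h e *\<^sub>R (W \<diamond> tp X)" by simp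
      finally show ?thesis
        unfolding g_def a_def b_def power2_norm_eq_inner
        by (simp add: h_def inner_add_left inner_add_right inner_diff_left inner_diff_right
            inner_commute power2_eq_square algebra_simps)
    qed
    moreover have "(g has_real_derivative (2 * a - 2 * b)) (at 0)"
      unfolding g_def h_def by (auto intro!: derivative_eq_intros)
    ultimately have "2 * a - 2 * b = 0"
      by (intro DERIV_local_min[of g _ 0 "1/2"]) auto
    moreover have "a - b = inner ?D X"
    proof -
      have "a = inner (tp Z \<diamond> Z - tp Z \<diamond> U) X"
      proof -
        have "a = inner X (tp Z \<diamond> (Z - U))"
          unfolding a_def by (subst inner_commute) (rule inner_mm_left)
        then show ?thesis by (simp only: mm.diff_right inner_commute)
      qed
      moreover have "b = inner (tp W \<diamond> W - tp V \<diamond> W) X"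
      proof -
        have "b = inner (tp X) (tp W \<diamond> (W - V))"
          unfolding b_def by (subst inner_commute) (rule inner_mm_left)
        then show ?thesis by (simp add: inner_tp mm_simps inner_commute)
      qed
      ultimately show ?thesis by (simp add: inner_diff_left)
    qed
    moreover have "inner X ?D = Poly_Mapping.lookup ?D (i, j)"
      by (simp add: X_def inner_poly_mapping_def)
    ultimately show "Poly_Mapping.lookup ?D (i, j) = Poly_Mapping.lookup 0 (i, j)"
      by (simp add: inner_commute)
  qed simp
  then show ?thesis using that Z W XZW by simp
qed

section \<open>Descent directions\<close>

lemma inner_mm_mm: "inner (a \<diamond> tp b) (c \<diamond> tp d) = inner (tp c \<diamond> a) (tp d \<diamond> b)"
proof -
  have "inner (a \<diamond> tp b) (c \<diamond> tp d) = inner ((tp c \<diamond> a) \<diamond> tp b) (tp d)"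
    by (metis inner_commute inner_mm_left mm_assoc)
  then show ?thesis by (simp add: inner_mm_right)
qed

lemma norm_complement:
  assumes "tp P = P" "P \<diamond> P = P"
  shows "(norm (d - P \<diamond> d))\<^sup>2 = (norm d)\<^sup>2 - (norm (P \<diamond> d))\<^sup>2"
proof -
  have "inner (P \<diamond> d) (P \<diamond> d) = inner d (P \<diamond> d)"
    using assms by (simp add: inner_mm_left mm_assoc[symmetric])
  then show ?thesis unfolding power2_norm_eq_inner
    by (simp add: inner_diff_left inner_diff_right inner_commute)
qed

text \<open>Put D = P Z U^T. By Pythagoras the left side is |Z U^T|^2 - |D|^2, and |D|^2 is at least
  <D, D^T> because |D - D^T|^2 \<ge> 0. As U^T P = U^T, the projection disappears from <D,
  D^T>.\<close>

lemma norm_complement_factor: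
  assumes P: "tp P = P" "P \<diamond> P = P" "P \<diamond> U = U"
  shows "(norm ((Z - P \<diamond> Z) \<diamond> tp U))\<^sup>2 \<le> inner (tp Z \<diamond> Z) (tp U \<diamond> U) - inner (tp U \<diamond> Z) (tp (tp U \<diamond> Z))"
proof -
  let ?d = "Z \<diamond> tp U"
  have UP: "tp U \<diamond> P = tp U" using P by (metis tp_mm tp_tp)
  have 1: "(Z - P \<diamond> Z) \<diamond> tp U = ?d - P \<diamond> ?d" by (simp add: mm_simps)
  have "0 \<le> (norm (P \<diamond> ?d - tp (P \<diamond> ?d)))\<^sup>2" by simp
  also have "\<dots> = 2 * (norm (P \<diamond> ?d))\<^sup>2 - 2 * inner (P \<diamond> ?d) (tp (P \<diamond> ?d))"
    unfolding power2_norm_eq_inner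
    by (simp add: inner_diff_left inner_diff_right inner_commute inner_tp)
  also have "inner (P \<diamond> ?d) (tp (P \<diamond> ?d)) = inner ((P \<diamond> Z) \<diamond> tp U) (U \<diamond> tp (P \<diamond> Z))"
    by (simp add: mm_simps)
  also have "\<dots> = inner (tp U \<diamond> (P \<diamond> Z)) (tp (P \<diamond> Z) \<diamond> U)" by (rule inner_mm_mm)
  also have "\<dots> = inner (tp U \<diamond> Z) (tp (tp U \<diamond> Z))"
    using P UP by (simp add: tp_mm mm_assoc[symmetric]) (simp add: mm_assoc P)
  finally have "inner (tp U \<diamond> Z) (tp (tp U \<diamond> Z)) \<le> (norm (P \<diamond> ?d))\<^sup>2" by simp
  moreover have "(norm ?d)\<^sup>2 = inner (tp Z \<diamond> Z) (tp U \<diamond> U)"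
    unfolding power2_norm_eq_inner by (rule inner_mm_mm)
  ultimately show ?thesis unfolding 1 norm_complement[OF P(1,2)] by simp
qed

text \<open>A and B are the parts normal to U and V of the nearest factorization (Z, W) of X.
  \<open>norm_complement_factor\<close> bounds both norms, and the terms it subtracts are, by
  criticality, exactly what the comparison with |X - U V^T|^2 requires.\<close>

lemma balanced_direction:
  assumes blk: "blk n r U" "blk m r V" "blk n r Z0" "blk m r W0" "blk n n P" "blk m m Q"
    and bal: "tp U \<diamond> U = tp V \<diamond> V"
    and P: "tp P = P" "P \<diamond> P = P" "P \<diamond> U = U" and Q: "tp Q = Q" "Q \<diamond> Q = Q" "Q \<diamond> V = V"
    and X: "X = Z0 \<diamond> tp W0"
  obtains A B where "blk n r A" "blk m r B" "P \<diamond> A = 0" "Q \<diamond> B = 0"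
    "A \<diamond> tp B = X - P \<diamond> X - (X - P \<diamond> X) \<diamond> Q"
    "(norm (U \<diamond> tp B))\<^sup>2 + (norm (A \<diamond> tp V))\<^sup>2 \<le> (norm (X - U \<diamond> tp V))\<^sup>2"
proof -
  obtain Z W where ZW: "blk n r Z" "blk m r W" "Z \<diamond> tp W = X"
    and crit: "tp Z \<diamond> Z - tp Z \<diamond> U = tp W \<diamond> W - tp V \<diamond> W"
    using factorization_critical[of n r U m V Z0 W0] blk X by metis
  define A where "A = Z - P \<diamond> Z"
  define B where "B = W - Q \<diamond> W"
  define Om where "Om = tp Z \<diamond> Z"
  define Ps where "Ps = tp W \<diamond> W"
  define S where "S = tp U \<diamond> U"
  define Y where "Y = tp U \<diamond> Z"
  define T where "T = tp V \<diamond> W"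
  define K where "K = Om - Ps"
  have K1: "K = tp Y - T"
    using crit by (simp add: K_def Om_def Ps_def Y_def T_def tp_mm algebra_simps)
  \<comment> \<open>Criticality writes the symmetric matrix \<open>K\<close> both as Y^T - T and as
    Y - T^T; pairing the two expressions gives |K|^2 in the quantities of the bounds.\<close>
  have "tp K = K" by (simp add: K_def Om_def Ps_def tp_diff tp_mm)
  then have K2: "K = Y - tp T" using K1 by (metis tp_diff tp_tp)
  have nK: "(norm K)\<^sup>2 = inner Y (tp Y) + inner T (tp T) - 2 * inner Y T"
  proof -
    have "(norm K)\<^sup>2 = inner (tp Y - T) (Y - tp T)"
      unfolding power2_norm_eq_inner using K1 K2 by metis
    then show ?thesis
      by (simp add: inner_diff_left inner_diff_right inner_tp inner_commute)
  qed
  \<comment> \<open>Balance gives |U B^T| = |V B^T|, so the complement estimate for V applies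
    although B is multiplied by U.\<close>
  have "(norm (U \<diamond> tp B))\<^sup>2 = (norm (tp (B \<diamond> tp V)))\<^sup>2"
    unfolding power2_norm_eq_inner tp_mm tp_tp
    by (simp add: inner_mm_left mm_assoc[symmetric] bal)
  also have "\<dots> = (norm ((W - Q \<diamond> W) \<diamond> tp V))\<^sup>2" unfolding norm_tp B_def ..
  also have "\<dots> \<le> inner Ps S - inner T (tp T)"
    using norm_complement_factor[OF Q, of W] bal by (simp add: Ps_def S_def T_def)
  finally have n1: "(norm (U \<diamond> tp B))\<^sup>2 \<le> inner Ps S - inner T (tp T)" .
  have "(norm (A \<diamond> tp V))\<^sup>2 = (norm (A \<diamond> tp U))\<^sup>2"
    unfolding power2_norm_eq_inner by (simp add: inner_mm_right mm_assoc bal)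
  also have "\<dots> \<le> inner Om S - inner Y (tp Y)"
    using norm_complement_factor[OF P, of Z] by (simp add: A_def Om_def S_def Y_def)
  finally have n2: "(norm (A \<diamond> tp V))\<^sup>2 \<le> inner Om S - inner Y (tp Y)" .
  have n3: "(norm (X - U \<diamond> tp V))\<^sup>2 = inner Om Ps + inner S S - 2 * inner Y T"
    unfolding power2_norm_eq_inner ZW(3)[symmetric]
    by (simp add: inner_diff_left inner_diff_right inner_mm_mm inner_commute Om_def Ps_def S_def Y_def T_def
        bal[symmetric])
      (metis inner_commute inner_mm_mm)
  \<comment> \<open>This square replaces <Om, S> + <Ps, S> by <Om, Ps> + <S, S> at the cost of
    |K|^2. By \<open>nK\<close> that cost cancels the subtracted terms of \<open>n1\<close> and
    \<open>n2\<close> and leaves the cross term of \<open>n3\<close>.\<close>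
  have "0 \<le> (norm (Om + Ps - 2 *\<^sub>R S))\<^sup>2" by simp
  also have "\<dots> = (norm K)\<^sup>2 + 4 * (inner Om Ps - inner Om S - inner Ps S + inner S S)"
    unfolding power2_norm_eq_inner K_def
    by (simp add: inner_diff_left inner_diff_right inner_add_left inner_add_right inner_commute)
  finally have "inner Om S + inner Ps S \<le> inner Om Ps + inner S S + (norm K)\<^sup>2"
    by (smt (verit) zero_le_power2)
  then have "(norm (U \<diamond> tp B))\<^sup>2 + (norm (A \<diamond> tp V))\<^sup>2 \<le> (norm (X - U \<diamond> tp V))\<^sup>2"
    using n1 n2 n3 nK by linarith
  moreover have "A \<diamond> tp B = X - P \<diamond> X - (X - P \<diamond> X) \<diamond> Q"
    by (simp add: A_def B_def ZW(3)[symmetric] mm_simps Q)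
  moreover have "P \<diamond> A = 0" "Q \<diamond> B = 0"
    by (simp_all add: A_def B_def mm_simps mm_assoc[symmetric] P Q)
  moreover have "blk n r A" "blk m r B"
    using ZW blk by (auto simp: A_def B_def intro!: blk_intros)
  ultimately show ?thesis using that by blast
qed

text \<open>Reduction to the balanced case: U V^T = U' V'^T for a balanced pair U' = U S, V' = V
  S^{-T}. Multiplying the directions found there by S^{-1} and S^T on the right preserves A B^T and
  turns U' B^T and A V'^T into the products with U and V.\<close>

lemma direction:
  assumes blk: "blk n r U" "blk m r V" "blk n r Z0" "blk m r W0" "blk n r L" "blk m r L'"
    and P: "P = U \<diamond> tp L" "tp P = P" "tp L \<diamond> U = un r"
    and Q: "Q = V \<diamond> tp L'" "tp Q = Q" "tp L' \<diamond> V = un r"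
    and X: "X = Z0 \<diamond> tp W0"
  obtains A B where "blk n r A" "blk m r B" "P \<diamond> A = 0" "Q \<diamond> B = 0"
    "A \<diamond> tp B = X - P \<diamond> X - (X - P \<diamond> X) \<diamond> Q"
    "(norm (U \<diamond> tp B))\<^sup>2 + (norm (A \<diamond> tp V))\<^sup>2 \<le> (norm (X - U \<diamond> tp V))\<^sup>2"
proof -
  \<comment> \<open>The factorization of U V^T nearest to (0, 0) is balanced.\<close>
  obtain U' V' where blk': "blk n r U'" "blk m r V'" and UV: "U' \<diamond> tp V' = U \<diamond> tp V"
    and bal0: "tp U' \<diamond> U' - tp U' \<diamond> 0 = tp V' \<diamond> V' - tp 0 \<diamond> V'"
    using factorization_critical[OF blk_zero blk_zero blk(1,2)] by metis
  have bal: "tp U' \<diamond> U' = tp V' \<diamond> V'"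
    using bal0 by (simp add: mm.zero_left mm.zero_right)
  define S where "S = tp L \<diamond> U'"
  define S' where "S' = tp L' \<diamond> V'"
  have S: "blk r r S" "blk r r S'" using blk blk' by (auto simp: S_def S'_def intro!: blk_intros)
  have blkPQ: "blk n n P" "blk m m Q" using blk by (auto simp: P(1) Q(1) intro!: blk_intros)
  have "S \<diamond> tp S' = tp L \<diamond> (U' \<diamond> tp V') \<diamond> L'" by (simp add: S_def S'_def mm_simps)
  also have "\<dots> = (tp L \<diamond> U) \<diamond> tp (tp L' \<diamond> V)" by (simp add: UV mm_simps)
  also have "\<dots> = un r" using P Q by (simp add: mm_un[OF blk_un])
  finally have SS: "tp S' \<diamond> S = un r" using square_inverse_commute S blk_tp by blast
  then have SS': "tp S \<diamond> S' = un r" by (metis tp_mm tp_tp tp_un)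
  have PU: "P \<diamond> U = U" using P blk by (simp add: mm_assoc)
  have QV: "Q \<diamond> V = V" using Q blk by (simp add: mm_assoc)
  have PP: "P \<diamond> P = P" using PU by (metis P(1) mm_assoc)
  have QQ: "Q \<diamond> Q = Q" using QV by (metis Q(1) mm_assoc)
  \<comment> \<open>Inserting 1 = S'^T S writes U' as U V^T times a matrix, so its columns lie in
    the range of P.\<close>
  have "P \<diamond> U' = P \<diamond> (U' \<diamond> tp V') \<diamond> (L' \<diamond> S)"
    using SS blk' by (simp add: S'_def mm_simps)
  also have "\<dots> = (U' \<diamond> tp V') \<diamond> (L' \<diamond> S)" unfolding UV by (simp add: mm_assoc[symmetric] PU)
  also have "\<dots> = U'" using SS blk' by (simp add: S'_def mm_simps)
  finally have PU': "P \<diamond> U' = U'" .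
  have VU: "V' \<diamond> tp U' = V \<diamond> tp U" using UV by (metis tp_mm tp_tp)
  have "Q \<diamond> V' = Q \<diamond> (V' \<diamond> tp U') \<diamond> (L \<diamond> S')"
    using SS' blk' by (simp add: S_def mm_simps)
  also have "\<dots> = (V' \<diamond> tp U') \<diamond> (L \<diamond> S')" unfolding VU by (simp add: mm_assoc[symmetric] QV)
  also have "\<dots> = V'" using SS' blk' by (simp add: S_def mm_simps)
  finally have QV': "Q \<diamond> V' = V'" .
  have US: "U \<diamond> S = U'" "V \<diamond> S' = V'" using PU' QV' by (simp_all add: P(1) Q(1) S_def S'_def mm_assoc)
  obtain A B where AB: "blk n r A" "blk m r B" "P \<diamond> A = 0" "Q \<diamond> B = 0"
    "A \<diamond> tp B = X - P \<diamond> X - (X - P \<diamond> X) \<diamond> Q"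
    "(norm (U' \<diamond> tp B))\<^sup>2 + (norm (A \<diamond> tp V'))\<^sup>2 \<le> (norm (X - U' \<diamond> tp V'))\<^sup>2"
    using balanced_direction[OF blk'(1,2) blk(3,4) blkPQ bal P(2) PP PU' Q(2) QQ QV' X] by metis
  show ?thesis
  proof (rule that)
    show "blk n r (A \<diamond> tp S')" "blk m r (B \<diamond> tp S)" using AB S by (auto intro!: blk_intros)
    show "P \<diamond> (A \<diamond> tp S') = 0" "Q \<diamond> (B \<diamond> tp S) = 0"
      using AB by (simp_all add: mm_assoc[symmetric] mm.zero_left)
    have "(A \<diamond> tp S') \<diamond> tp (B \<diamond> tp S) = A \<diamond> ((tp S' \<diamond> S) \<diamond> tp B)" by (simp add: mm_simps)
    also have "\<dots> = A \<diamond> tp B" using SS un_mm[OF blk_tp[OF AB(2)]] by simp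
    finally show "(A \<diamond> tp S') \<diamond> tp (B \<diamond> tp S) = X - P \<diamond> X - (X - P \<diamond> X) \<diamond> Q" using AB by simp
    have "U \<diamond> tp (B \<diamond> tp S) = U' \<diamond> tp B" "(A \<diamond> tp S') \<diamond> tp V = A \<diamond> tp V'"
      by (simp_all add: US[symmetric] mm_simps)
    then show "(norm (U \<diamond> tp (B \<diamond> tp S)))\<^sup>2 + (norm (A \<diamond> tp S' \<diamond> tp V))\<^sup>2 \<le> (norm (X - U \<diamond> tp V))\<^sup>2"
      using AB UV by simp
  qed
qed

text \<open>L = U (U^T U)^{-1}. The Gram matrix has trivial kernel because <w, U^T U w> = |U w|^2,
  and U L^T is the orthogonal projection onto the column space of U.\<close>

lemma projection_exists:
  assumes U: "blk n r U" and inj: "\<And>w. blk r 1 w \<Longrightarrow> U \<diamond> w = 0 \<Longrightarrow> w = 0"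
  obtains L where "blk n r L" "tp L \<diamond> U = un r" "tp (U \<diamond> tp L) = U \<diamond> tp L"
proof -
  let ?S = "tp U \<diamond> U"
  have S: "blk r r ?S" using U by (auto intro!: blk_intros)
  have "w = 0" if "blk r 1 w" "?S \<diamond> w = 0" for w
  proof -
    have "(norm (U \<diamond> w))\<^sup>2 = inner w (?S \<diamond> w)"
      unfolding power2_norm_eq_inner by (simp add: inner_mm_left mm_assoc)
    then show ?thesis using that inj by simp
  qed
  then obtain Y where Y: "blk r r Y" "?S \<diamond> Y = un r" "Y \<diamond> ?S = un r"
    using square_singular_or_inverse[OF S] by blast
  have tY: "tp Y \<diamond> ?S = un r" using Y(2) by (metis tp_mm tp_tp tp_un)
  have "tp Y = tp Y \<diamond> (?S \<diamond> Y)" using mm_un[OF blk_tp[OF Y(1)]] Y(2) by simp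
  also have "\<dots> = Y" by (metis mm_assoc tY un_mm Y(1))
  finally have "tp Y = Y" .
  show ?thesis
  proof (rule that[of "U \<diamond> Y"])
    show "blk n r (U \<diamond> Y)" using U Y by (auto intro!: blk_intros)
    show "tp (U \<diamond> Y) \<diamond> U = un r" using tY by (simp add: mm_simps)
    show "tp (U \<diamond> tp (U \<diamond> Y)) = U \<diamond> tp (U \<diamond> Y)" using \<open>tp Y = Y\<close> by (simp add: mm_simps)
  qed
qed

section \<open>Algebraic form of the critical point conditions\<close>

text \<open>With b = 0 an affine function is bounded below; with a = 0 the value 0 at s = 0 is a
  minimum. Used where one of two tangential terms vanishes.\<close>

lemma quadratic_nonneg_linear_zero:
  fixes a b :: real
  assumes "\<And>s. 0 \<le> a + b * s\<^sup>2 + c * s" "a = 0 \<or> b = 0"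
  shows "c = 0"
proof (rule ccontr)
  assume c: "c \<noteq> 0"
  show False
  proof (cases "b = 0")
    case True
    \<comment> \<open>At this argument the affine function equals -1.\<close>
    then show False using assms(1)[of "- (a + 1) / c"] c by (simp add: field_simps)
  next
    case False
    then have a: "a = 0" using assms(2) by simp
    have b: "0 < b"
    proof (rule ccontr)
      assume "\<not> 0 < b"
      then have "b < 0" using False by simp
      have "0 \<le> b * 1\<^sup>2 + c * 1" "0 \<le> b * (-1)\<^sup>2 + c * (-1)" using assms(1)[of 1] assms(1)[of "-1"] a by simp_all
      then show False using \<open>b < 0\<close> by simp
    qed
    \<comment> \<open>The vertex of the parabola.\<close>
    have "0 \<le> b * (- c / (2 * b))\<^sup>2 + c * (- c / (2 * b))" using assms(1)[of "- c / (2 * b)"] a by simp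
    also have "\<dots> = - (c\<^sup>2 / (4 * b))" using b by (simp add: field_simps power2_eq_square)
    finally show False using b c by (simp add: divide_le_0_iff)
  qed
qed

text \<open>A kernel vector w of U or V makes a tangential term vanish: with k = y w^T, A = G k and
  B = G^T A, either U B^T or A V^T is zero. When A alone is scaled, the linear coefficient 2 |B|^2
  must be zero; then A = 0, and with y running through the unit vectors every column of G
  vanishes.\<close>

lemma degenerate_gradient_zero:
  assumes blk: "blk n r U" "blk m r V" "blk n m G"
    and GV: "G \<diamond> V = 0" and UG: "tp U \<diamond> G = 0"
    and so: "\<And>A B. blk n r A \<Longrightarrow> blk m r B \<Longrightarrow> tp U \<diamond> A = 0 \<Longrightarrow> tp V \<diamond> B = 0 \<Longrightarrow>
      0 \<le> (1 + \<delta>) * (norm (U \<diamond> tp B + A \<diamond> tp V))\<^sup>2 + 2 * inner G (A \<diamond> tp B)"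
    and w: "blk r 1 w" "w \<noteq> 0" "U \<diamond> w = 0 \<or> V \<diamond> w = 0"
  shows "G = 0"
proof (rule blk_eqI[of n m])
  fix i j assume "i < n" "j < m"
  define y :: coords where "y = Poly_Mapping.single (j, 0) 1"
  have ly: "Poly_Mapping.lookup y (a, b) = (if a = j \<and> b = 0 then 1 else 0)" for a b
    by (auto simp: y_def lookup_single when_def)
  have y: "blk m 1 y" using \<open>j < m\<close> by (auto simp: blk_iff ly)
  define k where "k = y \<diamond> tp w"
  have k: "blk m r k" using y w by (auto simp: k_def intro!: blk_intros)
  define A where "A = G \<diamond> k"
  define B where "B = tp G \<diamond> A"
  have A: "blk n r A" and B: "blk m r B" using k blk by (auto simp: A_def B_def intro!: blk_intros)
  have VG: "tp V \<diamond> tp G = 0" using GV by (metis tp_mm tp_zero)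
  have orth: "tp U \<diamond> A = 0" "tp V \<diamond> B = 0"
    using UG VG by (simp_all add: A_def B_def mm_assoc[symmetric] mm.zero_left)
  have "U \<diamond> tp B = 0 \<or> A \<diamond> tp V = 0"
  proof -
    have "U \<diamond> tp B = ((U \<diamond> w) \<diamond> tp y) \<diamond> (tp G \<diamond> G)" by (simp add: B_def A_def k_def mm_simps)
    moreover have "A \<diamond> tp V = (G \<diamond> y) \<diamond> tp (V \<diamond> w)" by (simp add: A_def k_def mm_simps)
    ultimately show ?thesis using w(3) by (auto simp: mm.zero_left mm.zero_right)
  qed
  have GAB: "inner G (A \<diamond> tp B) = (norm B)\<^sup>2"
  proof -
    have "inner G (A \<diamond> tp B) = inner (tp A \<diamond> G) (tp B)"
      by (metis inner_commute inner_mm_left)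
    also have "tp A \<diamond> G = tp B" by (simp add: B_def mm_simps)
    finally show ?thesis by (simp add: inner_tp power2_norm_eq_inner)
  qed
  have "(2 * (norm B)\<^sup>2) = 0"
  proof (rule quadratic_nonneg_linear_zero)
    fix s :: real
    have "0 \<le> (1 + \<delta>) * (norm (U \<diamond> tp B + (s *\<^sub>R A) \<diamond> tp V))\<^sup>2 + 2 * inner G ((s *\<^sub>R A) \<diamond> tp B)"
      using A B orth by (intro so) (auto simp: mm.scaleR_right intro!: blk_intros)
    then show "0 \<le> (1 + \<delta>) * (norm (U \<diamond> tp B))\<^sup>2 + (1 + \<delta>) * (norm (A \<diamond> tp V))\<^sup>2 * s\<^sup>2 + 2 * (norm B)\<^sup>2 * s"
      using \<open>U \<diamond> tp B = 0 \<or> A \<diamond> tp V = 0\<close> GAB by (auto simp: mm.scaleR_left power_mult_distrib mult_ac)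
  next
    show "(1 + \<delta>) * (norm (U \<diamond> tp B))\<^sup>2 = 0 \<or> (1 + \<delta>) * (norm (A \<diamond> tp V))\<^sup>2 = 0"
      using \<open>U \<diamond> tp B = 0 \<or> A \<diamond> tp V = 0\<close> by auto
  qed
  then have "B = 0" by simp
  have "inner (G \<diamond> k) A = inner k B" unfolding B_def by (rule inner_mm_left)
  then have "(norm A)\<^sup>2 = inner k B" unfolding power2_norm_eq_inner using A_def by simp
  then have "A = 0" using \<open>B = 0\<close> by simp
  \<comment> \<open>Multiplying A = 0 by w from the right produces w^T w, the positive number
    |w|^2.\<close>
  then have "(G \<diamond> y) \<diamond> (tp w \<diamond> w) = 0" by (metis A_def k_def mm_assoc mm.zero_left)
  moreover have "tp w \<diamond> w = (norm w)\<^sup>2 *\<^sub>R un 1"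
  proof (rule blk_eqI[of 1 1])
    fix a b :: nat assume "a < 1" "b < 1"
    then show "Poly_Mapping.lookup (tp w \<diamond> w) (a, b) = Poly_Mapping.lookup ((norm w)\<^sup>2 *\<^sub>R un 1) (a, b)"
      using w unfolding power2_norm_eq_inner
      by (simp add: lookup_mm[OF blk_tp[OF w(1)]] lookup_tp lookup_scaleR lookup_un inner_blk[OF w(1)])
  qed (use w in \<open>auto intro!: blk_intros\<close>)
  ultimately have "(norm w)\<^sup>2 *\<^sub>R (G \<diamond> y) = 0"
    using mm_un[OF blk_mm[OF blk(3) y]] by (simp add: mm.scaleR_right)
  then have "G \<diamond> y = 0" using w by simp
  moreover have "Poly_Mapping.lookup (G \<diamond> y) (i, 0) = Poly_Mapping.lookup G (i, j)"
  proof -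
    have "Poly_Mapping.lookup (G \<diamond> y) (i, 0) = (\<Sum>k<m. if k = j then Poly_Mapping.lookup G (i, j) else 0)"
      unfolding lookup_mm[OF blk(3)] by (rule sum.cong) (auto simp: ly)
    then show ?thesis using \<open>j < m\<close> by simp
  qed
  ultimately show "Poly_Mapping.lookup G (i, j) = Poly_Mapping.lookup 0 (i, j)" by simp
qed (use blk in auto)

text \<open>From \<open>xe\<close> follows 3 x^2 \<le> y^2, and (3/2)^2 < 3 makes (1 + \<delta>) x <
  y. Hence the bound on g can be inserted into the square in \<open>h\<close>, which leaves (1 -
  \<delta>) y^2 - 2 x y + 2 x^2 \<le> 0. This form is positive definite exactly for \<delta> <
  1/2.\<close>

lemma no_gap_below_half:
  fixes x y g \<delta> :: real
  assumes \<delta>: "0 \<le> \<delta>" "\<delta> < 1/2" and x: "0 \<le> x" and y: "0 < y"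
    and xe: "x\<^sup>2 \<le> \<delta>\<^sup>2 * (x\<^sup>2 + y\<^sup>2)"
    and g: "g \<le> (1 + \<delta>) * x * y"
    and h: "(g / y - y)\<^sup>2 + x\<^sup>2 \<le> \<delta>\<^sup>2 * (x\<^sup>2 + y\<^sup>2)"
  shows False
proof -
  have "\<delta> * \<delta> \<le> 1/2 * (1/2)" using \<delta> by (intro mult_mono) auto
  then have d2: "\<delta>\<^sup>2 \<le> 1/4" by (simp add: power2_eq_square)
  have "x\<^sup>2 \<le> 1/4 * (x\<^sup>2 + y\<^sup>2)" using xe mult_right_mono[OF d2, of "x\<^sup>2 + y\<^sup>2"] by simp
  then have x3: "3 * x\<^sup>2 \<le> y\<^sup>2" by simp
  have xy: "(1 + \<delta>) * x < y"
  proof (rule ccontr)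
    assume "\<not> (1 + \<delta>) * x < y"
    then have "y\<^sup>2 \<le> ((1 + \<delta>) * x)\<^sup>2" using y by (intro power_mono) auto
    also have "\<dots> = (1 + \<delta>)\<^sup>2 * x\<^sup>2" by (simp add: power_mult_distrib)
    also have "\<dots> \<le> (3/2)\<^sup>2 * x\<^sup>2" using \<delta> by (intro mult_right_mono power_mono) auto
    finally have "3 * x\<^sup>2 \<le> 9/4 * x\<^sup>2" using x3 by (simp add: power2_eq_square)
    then have "x\<^sup>2 = 0" by simp
    then show False using \<open>\<not> (1 + \<delta>) * x < y\<close> y by simp
  qed
  have "g / y \<le> (1 + \<delta>) * x" using g y by (simp add: field_simps)
  then have "(y - (1 + \<delta>) * x)\<^sup>2 \<le> (y - g / y)\<^sup>2" using xy by (intro power_mono) auto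
  also have "\<dots> = (g / y - y)\<^sup>2" by (rule power2_commute)
  finally have "(y - (1 + \<delta>) * x)\<^sup>2 + x\<^sup>2 \<le> \<delta>\<^sup>2 * (x\<^sup>2 + y\<^sup>2)" using h by simp
  then have "(1 + \<delta>) * ((1 - \<delta>) * y\<^sup>2 - 2 * x * y + 2 * x\<^sup>2) \<le> 0"
    by (simp add: power2_eq_square algebra_simps)
  then have "(1 - \<delta>) * y\<^sup>2 - 2 * x * y + 2 * x\<^sup>2 \<le> 0" using \<delta> by (simp add: mult_le_0_iff)
  moreover have "1/2 * y\<^sup>2 < (1 - \<delta>) * y\<^sup>2" using \<delta> y by (intro mult_strict_right_mono) auto
  \<comment> \<open>At \<delta> = 1/2 the form is (y - 2 x)^2 / 2.\<close>
  moreover have "0 \<le> 1/2 * y\<^sup>2 - 2 * x * y + 2 * x\<^sup>2"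
    using zero_le_power2[of "y - 2 * x"] by (simp add: power2_eq_square algebra_simps)
  ultimately show False by linarith
qed

text \<open>The analytic input is reduced to two inequalities. \<open>so\<close> is the second-order
  condition in normal directions, with the Hessian replaced by its upper bound; \<open>rip\<close>
  compares -G with the error on matrices U a^T + Z b^T, whose rank is at most 2r. The error, its
  tangential part and its normal part all have this form.\<close>

lemma critical_point_unique:
  assumes \<delta>: "0 \<le> \<delta>" "\<delta> < 1/2"
    and blk: "blk n r U" "blk m r V" "blk n m G" "blk n r Z" "blk m r W"
    and GV: "G \<diamond> V = 0" and UG: "tp U \<diamond> G = 0"
    and so: "\<And>A B. blk n r A \<Longrightarrow> blk m r B \<Longrightarrow> tp U \<diamond> A = 0 \<Longrightarrow> tp V \<diamond> B = 0 \<Longrightarrow>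
      0 \<le> (1 + \<delta>) * (norm (U \<diamond> tp B + A \<diamond> tp V))\<^sup>2 + 2 * inner G (A \<diamond> tp B)"
    and rip: "\<And>a b. blk m r a \<Longrightarrow> blk m r b \<Longrightarrow>
      \<bar>inner G (U \<diamond> tp a + Z \<diamond> tp b) + inner (Z \<diamond> tp W - U \<diamond> tp V) (U \<diamond> tp a + Z \<diamond> tp b)\<bar>
        \<le> \<delta> * norm (Z \<diamond> tp W - U \<diamond> tp V) * norm (U \<diamond> tp a + Z \<diamond> tp b)"
  shows "Z \<diamond> tp W = U \<diamond> tp V"
proof -
  define M where "M = U \<diamond> tp V"
  define X where "X = Z \<diamond> tp W"
  define E where "E = X - M"
  have Ef: "E = U \<diamond> tp (- V) + Z \<diamond> tp W"
    by (simp add: E_def X_def M_def tp_minus mm.minus_right)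
  have rip': "\<bar>inner G w + inner E w\<bar> \<le> \<delta> * norm E * norm w"
    if "blk m r a" "blk m r b" "w = U \<diamond> tp a + Z \<diamond> tp b" for a b w
    using rip[OF that(1,2)] that(3) by (simp add: E_def X_def M_def)
  have zero_if_le: "E = 0" if "norm E * norm E \<le> \<delta> * norm E * norm E"
  proof (rule ccontr)
    assume "E \<noteq> 0"
    then have "0 < norm E * norm E" by simp
    moreover have "\<delta> * (norm E * norm E) \<le> 1/2 * (norm E * norm E)" using \<delta> by (intro mult_right_mono) auto
    ultimately show False using that by simp
  qed
  have "E = 0"
  proof (cases "\<exists>w. blk r 1 w \<and> w \<noteq> 0 \<and> (U \<diamond> w = 0 \<or> V \<diamond> w = 0)")
    \<comment> \<open>A rank-deficient factor forces G = 0; then testing with E itself gives |E|^2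
      \<le> \<delta> |E|^2.\<close>
    case True
    then have "G = 0" using degenerate_gradient_zero[OF blk(1-3) GV UG so] by blast
    then have "\<bar>inner E E\<bar> \<le> \<delta> * norm E * norm E"
      using rip'[of "- V" W E] Ef blk by (auto intro!: blk_intros)
    moreover have "inner E E = norm E * norm E" by (metis power2_norm_eq_inner power2_eq_square)
    ultimately show ?thesis using zero_if_le by linarith
  next
    case False
    obtain L where L: "blk n r L" "tp L \<diamond> U = un r" "tp (U \<diamond> tp L) = U \<diamond> tp L"
      by (rule projection_exists[OF blk(1)]) (use False in blast)
    obtain L' where L': "blk m r L'" "tp L' \<diamond> V = un r" "tp (V \<diamond> tp L') = V \<diamond> tp L'"
      by (rule projection_exists[OF blk(2)]) (use False in blast)
    define P where "P = U \<diamond> tp L"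
    define Q where "Q = V \<diamond> tp L'"
    have P: "tp P = P" "P \<diamond> U = U" using L blk by (simp_all add: P_def mm_assoc)
    have Q: "tp Q = Q" "Q \<diamond> V = V" using L' blk by (simp_all add: Q_def mm_assoc)
    have PP: "P \<diamond> P = P" using P by (metis P_def mm_assoc)
    have QQ: "Q \<diamond> Q = Q" using Q by (metis Q_def mm_assoc)
    have VQ: "tp V \<diamond> Q = tp V" using Q by (metis tp_mm tp_tp)
    have UP: "tp U \<diamond> P = tp U" using P by (metis tp_mm tp_tp)
    have PG: "P \<diamond> G = 0"
      by (metis P(1) P_def UG mm_assoc mm.zero_right tp_mm tp_tp)
    have GQ: "G \<diamond> Q = 0" using GV by (simp add: Q_def mm_assoc[symmetric] mm.zero_left)
    have PPx: "P \<diamond> (P \<diamond> x) = P \<diamond> x" for x by (metis PP mm_assoc)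
    have blkPQ: "blk n n P" "blk m m Q" using L L' blk by (auto simp: P_def Q_def intro!: blk_intros)
    have PM: "P \<diamond> M = M" "M \<diamond> Q = M" by (simp_all add: M_def mm_assoc VQ) (simp add: mm_assoc[symmetric] P)
    \<comment> \<open>The four blocks of E relative to P and Q: \<open>e1\<close> is P E Q,
      \<open>e2\<close> and \<open>e3\<close> are the mixed blocks, and \<open>N\<close> is normal
      on both sides. They are pairwise orthogonal, so |E|^2 = x^2 + y^2.\<close>
    define N where "N = X - P \<diamond> X - (X - P \<diamond> X) \<diamond> Q"
    define e1 where "e1 = P \<diamond> (X \<diamond> Q) - M"
    define e2 where "e2 = (X - P \<diamond> X) \<diamond> Q"
    define e3 where "e3 = P \<diamond> (X - X \<diamond> Q)"
    define x where "x = norm (e1 + e2 + e3)"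
    define y where "y = norm N"
    define g where "g = - inner G N"
    have innP: "inner (P \<diamond> a) b = inner a (P \<diamond> b)" for a b by (simp add: inner_mm_left P)
    have innQ: "inner (a \<diamond> Q) b = inner a (b \<diamond> Q)" for a b by (simp add: inner_mm_right Q)
    have P1: "P \<diamond> e1 = e1" "P \<diamond> e3 = e3" "P \<diamond> e2 = 0" "P \<diamond> N = 0"
      by (simp_all add: e1_def e2_def e3_def N_def mm_simps PPx PM)
    have Q1: "e1 \<diamond> Q = e1" "e2 \<diamond> Q = e2" "e3 \<diamond> Q = 0" "N \<diamond> Q = 0"
      by (simp_all add: e1_def e2_def e3_def N_def mm_simps QQ PM)
    have orth: "inner e1 e2 = 0" "inner e3 e2 = 0" "inner e1 N = 0" "inner e3 N = 0"
      "inner e1 e3 = 0" "inner e2 N = 0"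
      using innP[of e1 e2] innP[of e3 e2] innP[of e1 N] innP[of e3 N] innQ[of e1 e3] innQ[of e2 N]
      by (simp_all add: P1 Q1)
    have nsum: "(norm (e1 + s *\<^sub>R (e2 + e3) + t *\<^sub>R N))\<^sup>2
        = (norm e1)\<^sup>2 + s\<^sup>2 * ((norm e2)\<^sup>2 + (norm e3)\<^sup>2) + t\<^sup>2 * y\<^sup>2" for s t
      unfolding power2_norm_eq_inner y_def using orth
      by (simp add: inner_add_left inner_add_right inner_commute power2_eq_square algebra_simps)
    have x2: "x\<^sup>2 = (norm e1)\<^sup>2 + (norm e2)\<^sup>2 + (norm e3)\<^sup>2"
      using nsum[of 1 0] by (simp add: x_def add.assoc)
    have Esum: "E = e1 + e2 + e3 + N"
      by (simp add: E_def e1_def e2_def e3_def N_def mm_simps algebra_simps)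
    have E2: "(norm E)\<^sup>2 = x\<^sup>2 + y\<^sup>2"
      using nsum[of 1 1] by (simp add: Esum x2 add.assoc)
    \<comment> \<open>The normal parts of Z and W are shrunk by sqrt t. This scales \<open>N\<close>
      by t and the mixed blocks by sqrt t and leaves \<open>e1\<close> alone, so
      \<open>direction\<close> gives A B^T = t N with squared tangential norm at most x^2 + t^2
      y^2.\<close>
    have scaled: "2 * t * g \<le> (1 + \<delta>) * (x\<^sup>2 + t\<^sup>2 * y\<^sup>2)" if t: "0 \<le> t" "t \<le> 1" for t
    proof -
      define s where "s = sqrt t"
      have s2: "s\<^sup>2 = t" using t by (simp add: s_def)
      define Zs where "Zs = P \<diamond> Z + s *\<^sub>R (Z - P \<diamond> Z)"
      define Ws where "Ws = Q \<diamond> W + s *\<^sub>R (W - Q \<diamond> W)"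
      define Xs where "Xs = Zs \<diamond> tp Ws"
      have blks: "blk n r Zs" "blk m r Ws"
        using blk blkPQ by (auto simp: Zs_def Ws_def intro!: blk_intros)
      obtain A B where AB: "blk n r A" "blk m r B" "P \<diamond> A = 0" "Q \<diamond> B = 0"
          "A \<diamond> tp B = Xs - P \<diamond> Xs - (Xs - P \<diamond> Xs) \<diamond> Q"
          "(norm (U \<diamond> tp B))\<^sup>2 + (norm (A \<diamond> tp V))\<^sup>2 \<le> (norm (Xs - U \<diamond> tp V))\<^sup>2"
        using direction[OF blk(1,2) blks L(1) L'(1) P_def P(1) L(2) Q_def Q(1) L'(2) Xs_def] by metis
      have orthA: "tp U \<diamond> A = 0" "tp V \<diamond> B = 0"
        using AB(3,4) UP VQ by (metis mm_assoc mm.zero_right)+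
      have "inner (U \<diamond> tp B) (A \<diamond> tp V) = 0"
        by (subst inner_mm_left) (simp add: mm_assoc[symmetric] orthA mm.zero_left)
      then have nAB: "(norm (U \<diamond> tp B + A \<diamond> tp V))\<^sup>2 = (norm (U \<diamond> tp B))\<^sup>2 + (norm (A \<diamond> tp V))\<^sup>2"
        unfolding power2_norm_eq_inner by (simp add: inner_add_left inner_add_right inner_commute)
      have Xs: "Xs = P \<diamond> (X \<diamond> Q) + s *\<^sub>R (e2 + e3) + t *\<^sub>R N"
      proof -
        have "(P \<diamond> Z) \<diamond> tp (Q \<diamond> W) = P \<diamond> (X \<diamond> Q)" "(Z - P \<diamond> Z) \<diamond> tp (Q \<diamond> W) = e2"
          "(P \<diamond> Z) \<diamond> tp (W - Q \<diamond> W) = e3" "(Z - P \<diamond> Z) \<diamond> tp (W - Q \<diamond> W) = N"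
          by (simp_all add: e2_def e3_def N_def X_def mm_simps Q)
        then show ?thesis
          by (simp add: Xs_def Zs_def Ws_def mm.add_left mm.add_right mm.scaleR_left mm.scaleR_right
              tp_add tp_scaleR s2[symmetric] power2_eq_square scaleR_add_right del: tp_mm)
      qed
      have PXQ: "P \<diamond> (P \<diamond> (X \<diamond> Q)) = P \<diamond> (X \<diamond> Q)" "P \<diamond> (X \<diamond> Q) \<diamond> Q = P \<diamond> (X \<diamond> Q)"
        by (simp_all add: mm_assoc QQ PPx)
      have ABN: "A \<diamond> tp B = t *\<^sub>R N"
        unfolding AB(5) Xs
        by (simp add: mm.add_left mm.add_right mm.diff_left mm.scaleR_left mm.scaleR_right P1 Q1 PXQ algebra_simps)
      have "Xs - U \<diamond> tp V = e1 + s *\<^sub>R (e2 + e3) + t *\<^sub>R N"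
        unfolding Xs by (simp add: e1_def M_def)
      then have "(norm (Xs - U \<diamond> tp V))\<^sup>2 = (norm e1)\<^sup>2 + t * ((norm e2)\<^sup>2 + (norm e3)\<^sup>2) + t\<^sup>2 * y\<^sup>2"
        using nsum s2 by simp
      also have "\<dots> \<le> x\<^sup>2 + t\<^sup>2 * y\<^sup>2"
        using mult_left_le_one_le[of "(norm e2)\<^sup>2 + (norm e3)\<^sup>2" t] t x2 by simp
      finally have "(norm (U \<diamond> tp B + A \<diamond> tp V))\<^sup>2 \<le> x\<^sup>2 + t\<^sup>2 * y\<^sup>2" using AB(6) nAB by linarith
      then have "(1 + \<delta>) * (norm (U \<diamond> tp B + A \<diamond> tp V))\<^sup>2 \<le> (1 + \<delta>) * (x\<^sup>2 + t\<^sup>2 * y\<^sup>2)"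
        using \<delta> by (intro mult_left_mono) auto
      moreover have "inner G (A \<diamond> tp B) = - (t * g)" by (simp add: ABN g_def)
      ultimately show ?thesis using so[OF AB(1,2) orthA] by simp
    qed
    have NE: "N = E - (e1 + e2 + e3)" using Esum by simp
    \<comment> \<open>The tangential part is P (X - X Q) - M + X Q. The first two terms start with
      U, and X Q = Z (Q W)^T; so \<open>rip\<close> can be tested with this part, and also with
      \<open>N\<close>, its difference from E.\<close>
    have ETf: "e1 + e2 + e3 = U \<diamond> tp (tp (tp L \<diamond> (X - X \<diamond> Q) - tp V)) + Z \<diamond> tp (Q \<diamond> W)"
    proof -
      have "U \<diamond> (tp L \<diamond> Y) = P \<diamond> Y" for Y by (simp add: P_def mm_assoc)
      moreover have "Z \<diamond> (tp W \<diamond> Q) = X \<diamond> Q" by (simp add: X_def mm_assoc)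
      ultimately show ?thesis
        by (simp add: e1_def e2_def e3_def M_def mm_simps Q algebra_simps)
    qed
    have blkX: "blk n m X" using blk by (auto simp: X_def intro!: blk_intros)
    have blkET: "blk m r (tp (tp L \<diamond> (X - X \<diamond> Q) - tp V))" "blk m r (Q \<diamond> W)"
      using blk L(1) blkX blkPQ by (auto intro!: blk_intros)
    have ripc: "\<bar>inner G w + inner E w\<bar> \<le> \<delta> * norm E * norm w" if w: "w = - (e1 + e2 + e3) + c *\<^sub>R N" for w c
    proof (rule rip')
      let ?a = "tp (tp L \<diamond> (X - X \<diamond> Q) - tp V)" and ?b = "Q \<diamond> W"
      have "w = c *\<^sub>R E - (1 + c) *\<^sub>R (e1 + e2 + e3)" unfolding w NE by (simp add: algebra_simps)
      also have "\<dots> = U \<diamond> tp (c *\<^sub>R (- V) - (1 + c) *\<^sub>R ?a) + Z \<diamond> tp (c *\<^sub>R W - (1 + c) *\<^sub>R ?b)"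
        unfolding ETf Ef by (simp only: tp_diff tp_scaleR mm.diff_right mm.scaleR_right scaleR_right_distrib) simp
      finally show "w = \<dots>" .
      show "blk m r (c *\<^sub>R (- V) - (1 + c) *\<^sub>R ?a)" "blk m r (c *\<^sub>R W - (1 + c) *\<^sub>R ?b)"
        using blk blkET by (auto intro!: blk_intros)
    qed
    \<comment> \<open>P annihilates G from the left and Q from the right, while each tangential
      block is fixed by one of these multiplications.\<close>
    have GT: "inner G (e1 + e2 + e3) = 0"
    proof -
      have "inner G e1 = inner (P \<diamond> G) e1" "inner G e3 = inner (P \<diamond> G) e3" "inner G e2 = inner (G \<diamond> Q) e2"
        by (simp_all add: innP innQ P1 Q1)
      then show ?thesis by (simp add: PG GQ inner_add_right)
    qed
    have TN: "inner (e1 + e2 + e3) N = 0" using orth by (simp add: inner_add_left)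
    have ET: "inner E (e1 + e2 + e3) = x\<^sup>2" "inner E N = y\<^sup>2"
    proof -
      have "inner (v + N) v = (norm v)\<^sup>2" "inner (v + N) N = (norm N)\<^sup>2" if "inner v N = 0" for v
        using that unfolding power2_norm_eq_inner by (simp_all add: inner_add_left inner_add_right inner_commute)
      from this[OF TN] show "inner E (e1 + e2 + e3) = x\<^sup>2" "inner E N = y\<^sup>2"
        by (simp_all add: Esum x_def y_def)
    qed
    have nw: "(norm (- (e1 + e2 + e3) + c *\<^sub>R N))\<^sup>2 = x\<^sup>2 + c\<^sup>2 * y\<^sup>2" for c
    proof -
      have *: "(norm (- v + c *\<^sub>R N))\<^sup>2 = (norm v)\<^sup>2 + c\<^sup>2 * y\<^sup>2" if "inner v N = 0" for v
        unfolding power2_norm_eq_inner y_def using that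
        by (simp add: inner_add_left inner_add_right inner_diff_left inner_diff_right inner_commute power2_eq_square)
      show ?thesis unfolding x_def by (rule *[OF TN])
    qed
    \<comment> \<open>The condition on c says <-(G + E), w> = |w|^2, so the RIP bounds |w| by
      \<delta> |E|. It holds for c = 0 and for c = g / y^2 - 1; the latter makes w the projection of
      -(G + E) onto the span of the tangential part and \<open>N\<close>.\<close>
    have key: "x\<^sup>2 + c\<^sup>2 * y\<^sup>2 \<le> \<delta>\<^sup>2 * (x\<^sup>2 + y\<^sup>2)"
      if c: "c * g - c * y\<^sup>2 + x\<^sup>2 = x\<^sup>2 + c\<^sup>2 * y\<^sup>2" for c
    proof -
      define w where "w = - (e1 + e2 + e3) + c *\<^sub>R N"
      have "inner G w + inner E w = - (c * g) - x\<^sup>2 + c * y\<^sup>2"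
        unfolding w_def using GT ET by (simp only: inner_add_right inner_minus_right inner_scaleR_right g_def)
      then have "\<bar>x\<^sup>2 + c\<^sup>2 * y\<^sup>2\<bar> \<le> \<delta> * norm E * norm w" using ripc[OF w_def] c by simp
      then have "(norm w)\<^sup>2 \<le> \<delta> * norm E * norm w" using nw[of c] unfolding w_def by simp
      then have "norm w \<le> \<delta> * norm E"
        by (cases "norm w = 0") (use \<delta> in \<open>auto simp: power2_eq_square\<close>)
      then have "(norm w)\<^sup>2 \<le> (\<delta> * norm E)\<^sup>2" by (intro power_mono) auto
      then show ?thesis using nw[of c] unfolding w_def by (simp add: power_mult_distrib E2)
    qed
    have xe: "x\<^sup>2 \<le> \<delta>\<^sup>2 * (x\<^sup>2 + y\<^sup>2)" using key[of 0] by simp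
    show "E = 0"
    proof (cases "y = 0")
      case True
      have "\<delta>\<^sup>2 \<le> \<delta>" using \<delta> by (simp add: power2_eq_square mult_left_le)
      then have "\<delta>\<^sup>2 * (norm E)\<^sup>2 \<le> \<delta> * (norm E)\<^sup>2" by (intro mult_right_mono) auto
      then have "(norm E)\<^sup>2 \<le> \<delta> * (norm E)\<^sup>2" using xe E2 True by simp
      then show ?thesis by (intro zero_if_le) (simp add: power2_eq_square mult.assoc)
    next
      case False
      then have y: "0 < y" by (simp add: y_def)
      have x: "0 \<le> x" by (simp add: x_def)
      have "\<delta>\<^sup>2 \<le> (1/2)\<^sup>2" using \<delta> by (intro power_mono) auto
      then have "\<delta>\<^sup>2 * (x\<^sup>2 + y\<^sup>2) \<le> 1/4 * (x\<^sup>2 + y\<^sup>2)" by (intro mult_right_mono) (auto simp: power2_eq_square)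
      from order_trans[OF xe this] have "3 * x\<^sup>2 \<le> y\<^sup>2" by simp
      then have "x\<^sup>2 \<le> y\<^sup>2" using zero_le_power2[of x] by linarith
      then have xy: "x \<le> y" by (rule power2_le_imp_le) (use y in simp)
      \<comment> \<open>\<open>scaled\<close> is sharpest at t = x / y, where its two terms agree; x
        \<le> y makes this t admissible. For x = 0 this choice degenerates, and a small positive t
        refutes g > 0 instead.\<close>
      have g: "g \<le> (1 + \<delta>) * x * y"
      proof (cases "x = 0")
        case True
        show ?thesis
        proof (rule ccontr)
          assume "\<not> g \<le> (1 + \<delta>) * x * y"
          then have g0: "0 < g" using True by simp
          define q where "q = (1 + \<delta>) * y\<^sup>2"
          have q: "0 < q" using \<delta> y by (simp add: q_def)
          \<comment> \<open>The bound will demand 2 g \<le> t q, whereas t \<le> g / q gives t q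
            \<le> g; the minimum with 1 keeps t in the range of \<open>scaled\<close>.\<close>
          define t where "t = min 1 (g / q)"
          have t: "0 < t" "t \<le> 1" "t \<le> g / q" using g0 q by (auto simp: t_def)
          have "2 * t * g \<le> t * (t * q)" using scaled[of t] t True by (simp add: q_def power2_eq_square mult_ac)
          then have "2 * g \<le> t * q" using t(1) by simp
          also have "\<dots> \<le> g" using t(3) q by (simp add: field_simps)
          finally show False using g0 by simp
        qed
      next
        case False
        then have x: "0 < x" using x by simp
        have "2 * (x / y) * g \<le> (1 + \<delta>) * (x\<^sup>2 + (x / y)\<^sup>2 * y\<^sup>2)"
          using x y xy by (intro scaled) auto
        also have "\<dots> = 2 * (x / y) * ((1 + \<delta>) * x * y)"
          using y by (simp add: power2_eq_square field_simps)
        finally have "2 * (x / y) * g \<le> 2 * (x / y) * ((1 + \<delta>) * x * y)" .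
        moreover have "0 < 2 * (x / y)" using x y by simp
        ultimately show ?thesis by (simp only: mult_le_cancel_left_pos)
      qed
      have "x\<^sup>2 + (g / y\<^sup>2 - 1)\<^sup>2 * y\<^sup>2 \<le> \<delta>\<^sup>2 * (x\<^sup>2 + y\<^sup>2)"
        using y by (intro key) (simp add: power2_eq_square field_simps)
      moreover have "(g / y\<^sup>2 - 1)\<^sup>2 * y\<^sup>2 = (g / y - y)\<^sup>2"
        using y by (simp add: power2_eq_square field_simps)
      ultimately have "(g / y - y)\<^sup>2 + x\<^sup>2 \<le> \<delta>\<^sup>2 * (x\<^sup>2 + y\<^sup>2)" by simp
      then show ?thesis using no_gap_below_half[OF \<delta> x y xe g] by blast
    qed
  qed
  then show ?thesis by (simp add: E_def X_def M_def)
qed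

section \<open>Second derivatives in real inner product spaces\<close>

lemma nonpos_if_le_small_multiples:
  fixes c N :: real
  assumes N: "0 \<le> N" and le: "\<And>e. 0 < e \<Longrightarrow> c \<le> 4 * e * N"
  shows "c \<le> 0"
proof (rule ccontr)
  assume c: "\<not> c \<le> 0"
  \<comment> \<open>The summand 1 in the denominator makes the right side c N / (N + 1), which is
    below c even for N = 0.\<close>
  have "c \<le> 4 * (c / (4 * (N + 1))) * N" using c N by (intro le) simp
  also have "\<dots> = c * (N / (N + 1))" using N by (simp add: field_simps)
  also have "\<dots> < c * 1" using c N by (intro mult_strict_left_mono) (auto simp: field_simps)
  finally show False by simp
qed

context
  fixes g :: "'a :: real_inner \<Rightarrow> real"
  assumes g: "twice_cont_diff g"
begin

section \<open>Derivatives along lines, symmetry of the Hessian and the RIP on segments\<close>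

lemma gradient_has_derivative: "(g has_derivative (\<lambda>h. inner h (gradient g x))) (at x)"
proof -
  obtain D where "GDERIV g x :> D" using g by (auto simp: twice_cont_diff_def)
  then show ?thesis using gradient_eqI by (auto simp: gderiv_def)
qed

lemma hessian_has_derivative: "(gradient g has_derivative hessian g x) (at x)"
  using g by (auto simp: twice_cont_diff_def hessian_def frechet_derivative_works)

lemma linear_hessian: "linear (hessian g x)"
  using hessian_has_derivative has_derivative_linear by blast

lemma line_has_derivative:
  "((\<lambda>t. g (x + t *\<^sub>R h)) has_real_derivative inner h (gradient g (x + t *\<^sub>R h))) (at t)"
proof -
  have "((\<lambda>t. g (x + t *\<^sub>R h)) has_derivative (\<lambda>s. inner (s *\<^sub>R h) (gradient g (x + t *\<^sub>R h)))) (at t)"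
    by (rule has_derivative_compose[OF _ gradient_has_derivative]) (auto intro!: derivative_eq_intros)
  then show ?thesis by (simp add: has_field_derivative_def mult_commute_abs)
qed

lemma line_gradient_has_derivative:
  "((\<lambda>t. inner (gradient g (x + t *\<^sub>R h)) w) has_real_derivative inner (hessian g (x + t *\<^sub>R h) h) w) (at t)"
proof -
  have "((\<lambda>t. gradient g (x + t *\<^sub>R h)) has_derivative (\<lambda>s. hessian g (x + t *\<^sub>R h) (s *\<^sub>R h))) (at t)"
    by (rule has_derivative_compose[OF _ hessian_has_derivative]) (auto intro!: derivative_eq_intros)
  then have "((\<lambda>t. inner (gradient g (x + t *\<^sub>R h)) w) has_derivative
      (\<lambda>s. inner (hessian g (x + t *\<^sub>R h) (s *\<^sub>R h)) w)) (at t)"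
    by (auto intro!: derivative_eq_intros)
  then show ?thesis
    by (simp add: has_field_derivative_def linear_cmul[OF linear_hessian] mult_commute_abs)
qed

text \<open>The difference of the four values of \<open>g\<close> is symmetric in \<open>h\<close> and \<open>k\<close>, hence so is the Hessian.\<close>

lemma second_difference:
  assumes "0 < e"
  obtains d where "0 < d" "\<And>t. 0 < t \<Longrightarrow> t * (norm h + norm k) < d \<Longrightarrow>
    \<bar>g (x + t *\<^sub>R h + t *\<^sub>R k) - g (x + t *\<^sub>R h) - g (x + t *\<^sub>R k) + g x - t\<^sup>2 * inner (hessian g x k) h\<bar>
      \<le> 2 * e * t\<^sup>2 * (norm h + norm k)\<^sup>2"
proof -
  obtain d where d: "0 < d" "\<And>y. norm (y - x) < d \<Longrightarrow>
      norm (gradient g y - gradient g x - hessian g x (y - x)) \<le> e * norm (y - x)"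
    using hessian_has_derivative[of x] assms unfolding has_derivative_at_alt by meson
  have "\<bar>g (x + t *\<^sub>R h + t *\<^sub>R k) - g (x + t *\<^sub>R h) - g (x + t *\<^sub>R k) + g x - t\<^sup>2 * inner (hessian g x k) h\<bar>
      \<le> 2 * e * t\<^sup>2 * (norm h + norm k)\<^sup>2" if t: "0 < t" "t * (norm h + norm k) < d" for t
  proof -
    \<comment> \<open>The mean value theorem for \<open>p\<close> turns the second difference into a
      difference of two gradients, each compared with its linear approximation at x.\<close>
    define p where "p = (\<lambda>s. g ((x + t *\<^sub>R k) + s *\<^sub>R h) - g (x + s *\<^sub>R h))"
    have "(p has_real_derivative inner h (gradient g ((x + t *\<^sub>R k) + s *\<^sub>R h)) - inner h (gradient g (x + s *\<^sub>R h))) (at s)" for s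
      unfolding p_def by (intro DERIV_diff line_has_derivative)
    from MVT2[OF t(1) this] obtain s where s: "0 < s" "s < t"
      "p t - p 0 = t * (inner h (gradient g ((x + t *\<^sub>R k) + s *\<^sub>R h)) - inner h (gradient g (x + s *\<^sub>R h)))"
      by auto
    let ?u = "s *\<^sub>R h" and ?v = "t *\<^sub>R k + s *\<^sub>R h"
    let ?r = "\<lambda>u. gradient g (x + u) - gradient g x - hessian g x u"
    let ?n = "t * (norm h + norm k)"
    have nu: "norm ?u \<le> ?n" "norm ?v \<le> ?n"
    proof -
      have 1: "norm ?u \<le> t * norm h" using s by (simp add: mult_right_mono)
      then show "norm ?u \<le> ?n" using t(1) by (smt (verit) distrib_left mult_nonneg_nonneg norm_ge_zero)
      have "norm ?v \<le> norm (t *\<^sub>R k) + norm ?u" by (rule norm_triangle_ineq)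
      then show "norm ?v \<le> ?n" using 1 t(1) by (simp add: distrib_left)
    qed
    have r: "norm (?r u) \<le> e * ?n" if "norm u \<le> ?n" for u
    proof -
      have "norm (?r u) \<le> e * norm u" using d(2)[of "x + u"] that t(2) by simp
      also have "\<dots> \<le> e * ?n" using that assms by (intro mult_left_mono) auto
      finally show ?thesis .
    qed
    have "hessian g x ?v = t *\<^sub>R hessian g x k + hessian g x ?u"
      by (simp add: linear_add[OF linear_hessian] linear_cmul[OF linear_hessian])
    then have "gradient g (x + ?v) - gradient g (x + ?u) = t *\<^sub>R hessian g x k + (?r ?v - ?r ?u)" by simp
    then have "inner (gradient g (x + ?v) - gradient g (x + ?u)) h
        = t * inner (hessian g x k) h + inner (?r ?v - ?r ?u) h"
      by (metis inner_add_left inner_scaleR_left)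
    moreover have "p t - p 0 = t * inner (gradient g (x + ?v) - gradient g (x + ?u)) h"
      using s(3) by (simp add: inner_diff_left inner_diff_right inner_commute add.assoc)
    ultimately have "p t - p 0 - t\<^sup>2 * inner (hessian g x k) h = t * inner (?r ?v - ?r ?u) h"
      by (simp add: power2_eq_square distrib_left)
    also have "\<bar>\<dots>\<bar> \<le> t * ((2 * (e * ?n)) * norm h)"
    proof -
      have "\<bar>inner (?r ?v - ?r ?u) h\<bar> \<le> norm (?r ?v - ?r ?u) * norm h" by (rule Cauchy_Schwarz_ineq2)
      also have "\<dots> \<le> (2 * (e * ?n)) * norm h"
        using norm_triangle_ineq4[of "?r ?v" "?r ?u"] r[OF nu(1)] r[OF nu(2)] by (intro mult_right_mono) auto
      finally show ?thesis using t(1) by (simp add: abs_mult)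
    qed
    also have "\<dots> \<le> t * ((2 * (e * ?n)) * (norm h + norm k))"
      using t(1) assms by (intro mult_left_mono mult_nonneg_nonneg) auto
    finally have "\<bar>p t - p 0 - t\<^sup>2 * inner (hessian g x k) h\<bar> \<le> 2 * e * t\<^sup>2 * (norm h + norm k)\<^sup>2"
      by (simp add: power2_eq_square mult_ac)
    moreover have "p t - p 0 = g (x + t *\<^sub>R h + t *\<^sub>R k) - g (x + t *\<^sub>R h) - g (x + t *\<^sub>R k) + g x"
      by (simp add: p_def algebra_simps)
    ultimately show ?thesis by simp
  qed
  then show ?thesis using d(1) that by blast
qed

lemma hessian_symmetric: "inner (hessian g x h) k = inner (hessian g x k) h"
proof -
  let ?c = "\<bar>inner (hessian g x k) h - inner (hessian g x h) k\<bar>" and ?N = "(norm h + norm k)\<^sup>2"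
  have le: "?c \<le> 4 * e * ?N" if e: "0 < e" for e
  proof -
    obtain d1 where d1: "0 < d1" "\<And>t. 0 < t \<Longrightarrow> t * (norm h + norm k) < d1 \<Longrightarrow>
      \<bar>g (x + t *\<^sub>R h + t *\<^sub>R k) - g (x + t *\<^sub>R h) - g (x + t *\<^sub>R k) + g x - t\<^sup>2 * inner (hessian g x k) h\<bar>
        \<le> 2 * e * t\<^sup>2 * ?N"
      using second_difference[OF e, where h=h and k=k and x=x] by blast
    obtain d2 where d2: "0 < d2" "\<And>t. 0 < t \<Longrightarrow> t * (norm k + norm h) < d2 \<Longrightarrow>
      \<bar>g (x + t *\<^sub>R k + t *\<^sub>R h) - g (x + t *\<^sub>R k) - g (x + t *\<^sub>R h) + g x - t\<^sup>2 * inner (hessian g x h) k\<bar>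
        \<le> 2 * e * t\<^sup>2 * (norm k + norm h)\<^sup>2"
      using second_difference[OF e, where h=k and k=h and x=x] by blast
    \<comment> \<open>Small enough for both estimates; the 1 in the denominator covers h = k = 0.
      Each order of h and k contributes 2 e, hence the 4 e.\<close>
    define t where "t = min d1 d2 / (2 * (norm h + norm k + 1))"
    have n: "0 < norm h + norm k + 1" using norm_ge_zero[of h] norm_ge_zero[of k] by linarith
    have t: "0 < t" using d1 d2 n by (simp add: t_def)
    have "t * (norm h + norm k) \<le> t * (norm h + norm k + 1)" using t by simp
    also have "\<dots> = min d1 d2 / 2" using n by (simp add: t_def field_simps)
    also have "\<dots> < min d1 d2" using d1(1) d2(1) by (simp add: min_def)
    finally have "t * (norm h + norm k) < d1" "t * (norm k + norm h) < d2" by (simp_all add: add.commute)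
    note b = d1(2)[OF t this(1)] d2(2)[OF t this(2)]
    have swap: "x + t *\<^sub>R k + t *\<^sub>R h = x + t *\<^sub>R h + t *\<^sub>R k" by simp
    have "\<bar>t\<^sup>2 * inner (hessian g x k) h - t\<^sup>2 * inner (hessian g x h) k\<bar> \<le> 4 * e * t\<^sup>2 * ?N"
      using b unfolding swap add.commute[of "norm k"] by linarith
    then have "t\<^sup>2 * ?c \<le> t\<^sup>2 * (4 * e * ?N)"
      by (simp add: right_diff_distrib[symmetric] abs_mult mult_ac)
    then show ?thesis using t by simp
  qed
  have "?c \<le> 0" by (rule nonpos_if_le_small_multiples[OF _ le]) simp
  then show ?thesis by simp
qed

text \<open>Polarization of the symmetric form B, the Hessian minus the inner product, on the plane
  spanned by e and w. Scaling both vectors to the common norm |e| |w| first makes the parallelogram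
  law yield the product of the norms instead of a sum of squares.\<close>

lemma hessian_polarization:
  assumes rip: "\<And>a b. \<bar>inner (hessian g x (a *\<^sub>R e + b *\<^sub>R w)) (a *\<^sub>R e + b *\<^sub>R w) - (norm (a *\<^sub>R e + b *\<^sub>R w))\<^sup>2\<bar>
      \<le> \<delta> * (norm (a *\<^sub>R e + b *\<^sub>R w))\<^sup>2"
  shows "\<bar>inner (hessian g x e) w - inner e w\<bar> \<le> \<delta> * norm e * norm w"
proof (cases "e = 0 \<or> w = 0")
  case True
  then show ?thesis using linear_0[OF linear_hessian] by auto
next
  case False
  define B where "B = (\<lambda>a b. inner (hessian g x a) b - inner a b)"
  have B_add: "B (a + a') b = B a b + B a' b" "B b (a + a') = B b a + B b a'"
    "B (a - a') b = B a b - B a' b" "B b (a - a') = B b a - B b a'" for a a' b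
    by (simp_all add: B_def linear_add[OF linear_hessian] linear_diff[OF linear_hessian]
        inner_add_left inner_add_right inner_diff_left inner_diff_right)
  have B_sym: "B a b = B b a" for a b
    unfolding B_def using hessian_symmetric by (simp add: inner_commute)
  let ?a = "norm w *\<^sub>R e" and ?b = "norm e *\<^sub>R w"
  have 1: "\<bar>B (?a + ?b) (?a + ?b)\<bar> \<le> \<delta> * (norm (?a + ?b))\<^sup>2"
    unfolding B_def using rip[of "norm w" "norm e"] by (simp add: power2_norm_eq_inner)
  have 2: "\<bar>B (?a - ?b) (?a - ?b)\<bar> \<le> \<delta> * (norm (?a - ?b))\<^sup>2"
    unfolding B_def using rip[of "norm w" "- norm e"] by (simp add: power2_norm_eq_inner)
  have "B (?a + ?b) (?a + ?b) - B (?a - ?b) (?a - ?b) = 4 * B ?a ?b"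
    using B_sym[of ?b ?a] by (simp add: B_add)
  also have "B ?a ?b = (norm e * norm w) * B e w"
    by (simp add: B_def linear_cmul[OF linear_hessian] algebra_simps)
  finally have "4 * ((norm e * norm w) * B e w) = B (?a + ?b) (?a + ?b) - B (?a - ?b) (?a - ?b)" ..
  then have "4 * \<bar>(norm e * norm w) * B e w\<bar> \<le> \<delta> * (norm (?a + ?b))\<^sup>2 + \<delta> * (norm (?a - ?b))\<^sup>2"
    using 1 2 by linarith
  also have "\<dots> = \<delta> * ((norm (?a + ?b))\<^sup>2 + (norm (?a - ?b))\<^sup>2)" by (simp add: distrib_left)
  also have "(norm (?a + ?b))\<^sup>2 + (norm (?a - ?b))\<^sup>2 = 2 * (norm ?a)\<^sup>2 + 2 * (norm ?b)\<^sup>2"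
  proof -
    have "(norm (a + b))\<^sup>2 + (norm (a - b))\<^sup>2 = 2 * (norm a)\<^sup>2 + 2 * (norm b)\<^sup>2" for a b :: 'a
      unfolding power2_norm_eq_inner
      by (simp add: inner_add_left inner_add_right inner_diff_left inner_diff_right)
    then show ?thesis .
  qed
  also have "\<delta> * \<dots> = 4 * ((norm e * norm w) * (\<delta> * norm e * norm w))"
    by (simp add: power2_eq_square)
  finally have "(norm e * norm w) * \<bar>B e w\<bar> \<le> (norm e * norm w) * (\<delta> * norm e * norm w)"
    by (simp add: abs_mult)
  then show ?thesis using False by (simp add: B_def)
qed

text \<open>On the segment from x to x + e the mean value theorem expresses -<grad g(x), w> as the
  Hessian pairing of e and w at an intermediate point, where polarization applies. The hypothesis
  stays on one line and one plane, so that matrices of bounded rank can satisfy it.\<close>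

lemma gradient_difference_rip:
  assumes crit: "inner (gradient g (x + e)) w = 0"
    and rip: "\<And>t a b. \<bar>inner (hessian g (x + t *\<^sub>R e) (a *\<^sub>R e + b *\<^sub>R w)) (a *\<^sub>R e + b *\<^sub>R w) - (norm (a *\<^sub>R e + b *\<^sub>R w))\<^sup>2\<bar>
      \<le> \<delta> * (norm (a *\<^sub>R e + b *\<^sub>R w))\<^sup>2"
  shows "\<bar>inner (gradient g x) w + inner e w\<bar> \<le> \<delta> * norm e * norm w"
proof -
  have "\<exists>z>0. z < 1 \<and> inner (gradient g (x + 1 *\<^sub>R e)) w - inner (gradient g (x + 0 *\<^sub>R e)) w = (1 - 0) * inner (hessian g (x + z *\<^sub>R e) e) w"
    by (rule MVT2[where f="\<lambda>t. inner (gradient g (x + t *\<^sub>R e)) w"]) (simp, rule line_gradient_has_derivative)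
  then
  obtain t where "inner (gradient g (x + 1 *\<^sub>R e)) w - inner (gradient g (x + 0 *\<^sub>R e)) w
      = (1 - 0) * inner (hessian g (x + t *\<^sub>R e) e) w" by blast
  then have "- inner (gradient g x) w = inner (hessian g (x + t *\<^sub>R e) e) w" using crit by simp
  then show ?thesis using hessian_polarization[OF rip, of t] by simp
qed

text \<open>Convexity along one line: the mean value theorem is applied to g and then to its
  directional derivative.\<close>

lemma critical_point_minimal_on_segment:
  assumes crit: "inner (gradient g x) e = 0"
    and pos: "\<And>t. 0 \<le> inner (hessian g (x + t *\<^sub>R e) e) e"
  shows "g x \<le> g (x + e)"
proof -
  have "\<exists>z>0. z < 1 \<and> g (x + 1 *\<^sub>R e) - g (x + 0 *\<^sub>R e) = (1 - 0) * inner e (gradient g (x + z *\<^sub>R e))"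
    by (rule MVT2[where f="\<lambda>t. g (x + t *\<^sub>R e)"]) (simp, rule line_has_derivative)
  then
  obtain t where t: "0 < t" "g (x + 1 *\<^sub>R e) - g (x + 0 *\<^sub>R e) = (1 - 0) * inner e (gradient g (x + t *\<^sub>R e))"
    by blast
  have "\<exists>z>0. z < t \<and> inner (gradient g (x + t *\<^sub>R e)) e - inner (gradient g (x + 0 *\<^sub>R e)) e = (t - 0) * inner (hessian g (x + z *\<^sub>R e) e) e"
    by (rule MVT2[where f="\<lambda>t. inner (gradient g (x + t *\<^sub>R e)) e"]) (rule t(1) line_gradient_has_derivative)+
  then
  obtain s where "inner (gradient g (x + t *\<^sub>R e)) e - inner (gradient g (x + 0 *\<^sub>R e)) e
      = (t - 0) * inner (hessian g (x + s *\<^sub>R e) e) e" by blast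
  then have "0 \<le> inner (gradient g (x + t *\<^sub>R e)) e" using crit pos[of s] t(1) by simp
  then show ?thesis using t(2) by (simp add: inner_commute)
qed

end

text \<open>A function that depends on finitely many coordinates has a gradient even though the space
  need not be complete.\<close>

lemma second_order_critical_directional:
  fixes \<phi> :: "'a :: real_inner \<Rightarrow> real" and e :: "'i \<Rightarrow> 'a"
  assumes D: "\<And>q. (\<phi> has_derivative D q) (at q)"
    and D2: "\<And>h. ((\<lambda>q. D q h) has_derivative D2 h) (at p)"
    and fin: "\<And>q h. D q h = (\<Sum>i\<in>I. inner h (e i) * D q (e i))"
    and crit: "second_order_critical \<phi> p"
  shows "D p h = 0" "0 \<le> D2 h h"
proof -
  let ?G = "\<lambda>q. \<Sum>i\<in>I. D q (e i) *\<^sub>R e i"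
  have "GDERIV \<phi> q :> ?G q" for q
  proof -
    have "D q = (\<lambda>h. inner h (?G q))"
      by (rule ext) (subst fin, simp add: inner_sum_right mult.commute)
    then show ?thesis using D[of q] by (simp add: gderiv_def)
  qed
  then have grad: "gradient \<phi> = ?G" by (intro ext gradient_eqI)
  have inn: "inner h (?G q) = D q h" for q h
    by (subst fin) (simp add: inner_sum_right mult.commute)
  show "D p h = 0" using inn[of h p] grad crit by (simp add: second_order_critical_def)
  have "(gradient \<phi> has_derivative (\<lambda>k. \<Sum>i\<in>I. D2 (e i) k *\<^sub>R e i)) (at p)"
    unfolding grad by (intro has_derivative_sum has_derivative_scaleR_left D2)
  then have hess: "hessian \<phi> p = (\<lambda>k. \<Sum>i\<in>I. D2 (e i) k *\<^sub>R e i)"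
    unfolding hessian_def by (rule frechet_derivative_at[symmetric])
  have "((\<lambda>q. \<Sum>i\<in>I. inner h (e i) * D q (e i)) has_derivative (\<lambda>k. \<Sum>i\<in>I. inner h (e i) * D2 (e i) k)) (at p)"
    by (intro has_derivative_sum has_derivative_mult_right D2)
  then have "((\<lambda>q. D q h) has_derivative (\<lambda>k. \<Sum>i\<in>I. inner h (e i) * D2 (e i) k)) (at p)"
    by (subst fin)
  \<comment> \<open>\<open>D2 h\<close> is given separately for every h; uniqueness of derivatives
    makes it a combination of the \<open>D2 (e i)\<close> and thereby the quadratic form of the
    Hessian.\<close>
  with D2 have "D2 h = (\<lambda>k. \<Sum>i\<in>I. inner h (e i) * D2 (e i) k)" by (rule has_derivative_unique)
  then have "D2 h h = (\<Sum>i\<in>I. inner h (e i) * D2 (e i) h)" by (rule fun_cong)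
  also have "\<dots> = inner (hessian \<phi> p h) h"
    unfolding hess inner_sum_left by (rule sum.cong) (simp_all add: inner_commute)
  finally show "0 \<le> D2 h h" using crit by (metis second_order_critical_def)
qed

section \<open>Critical points of the factorized objective\<close>

lemmas has_derivative_mm [derivative_intros] = bounded_bilinear.FDERIV[OF mm.bounded_bilinear_axioms]
lemmas has_derivative_tp [derivative_intros] = bounded_linear.has_derivative[OF bounded_linear_tp]
lemmas has_derivative_pr [derivative_intros] = bounded_linear.has_derivative[OF bounded_linear_pr]

lemma lookup_sum: "Poly_Mapping.lookup (\<Sum>i\<in>I. f i) k = (\<Sum>i\<in>I. Poly_Mapping.lookup (f i :: coords) k)"
  by (induction I rule: infinite_finite_induct) (auto simp: lookup_add)

lemma pr_expansion: "pr n m x = (\<Sum>k\<in>{..<n} \<times> {..<m}. inner x (Poly_Mapping.single k 1) *\<^sub>R Poly_Mapping.single k 1)"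
proof (rule coords_eqI)
  fix i j
  have "inner x (Poly_Mapping.single k 1) = Poly_Mapping.lookup x k" for k
    by (subst inner_commute) (simp add: inner_poly_mapping_def)
  then show "Poly_Mapping.lookup (pr n m x) (i, j) = Poly_Mapping.lookup
      (\<Sum>k\<in>{..<n} \<times> {..<m}. inner x (Poly_Mapping.single k 1) *\<^sub>R Poly_Mapping.single k 1) (i, j)"
    by (simp add: lookup_sum lookup_scaleR lookup_single when_def lookup_pr if_distrib cong: if_cong)
qed

text \<open>The values c = 0 and c = \<mu>/4 cover the two objectives. \<open>L\<close> and 2 A B^T
  are the first and second derivatives of U V^T in the direction (A, B); \<open>R\<close> is the
  imbalance and \<open>R1\<close> its first derivative.\<close>

lemma second_order_conditions:
  assumes F: "twice_cont_diff F" and UV: "blk n r U" "blk m r V"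
    and crit: "second_order_critical (\<lambda>(x, y). F (pr n r x \<diamond> tp (pr m r y)) +
        c * (norm (tp (pr n r x) \<diamond> pr n r x - tp (pr m r y) \<diamond> pr m r y))\<^sup>2) (U, V)"
    and AB: "blk n r A" "blk m r B"
  defines "M \<equiv> U \<diamond> tp V" and "R \<equiv> tp U \<diamond> U - tp V \<diamond> V"
    and "L \<equiv> A \<diamond> tp V + U \<diamond> tp B" and "R1 \<equiv> tp A \<diamond> U + tp U \<diamond> A - (tp B \<diamond> V + tp V \<diamond> B)"
  shows "inner (gradient F M) L + 2 * c * inner R R1 = 0"
    and "0 \<le> inner (hessian F M L) L + 2 * inner (gradient F M) (A \<diamond> tp B)
      + 2 * c * ((norm R1)\<^sup>2 + 2 * inner R (tp A \<diamond> A - tp B \<diamond> B))"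
proof -
  let ?x = "\<lambda>q. pr n r (fst q)" and ?y = "\<lambda>q. pr m r (snd q)"
  let ?R = "\<lambda>q. tp (?x q) \<diamond> ?x q - tp (?y q) \<diamond> ?y q"
  let ?dL = "\<lambda>q h. ?x h \<diamond> tp (?y q) + ?x q \<diamond> tp (?y h)"
  let ?dR = "\<lambda>q h. tp (?x h) \<diamond> ?x q + tp (?x q) \<diamond> ?x h - (tp (?y h) \<diamond> ?y q + tp (?y q) \<diamond> ?y h)"
  define \<phi> where "\<phi> = (\<lambda>q. F (?x q \<diamond> tp (?y q)) + c * inner (?R q) (?R q))"
  define D where "D = (\<lambda>q h. inner (?dL q h) (gradient F (?x q \<diamond> tp (?y q))) + 2 * c * inner (?R q) (?dR q h))"
  define D2 where "D2 = (\<lambda>h k. inner (?dL (U, V) h) (hessian F M (?dL (U, V) k))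
      + inner (?x h \<diamond> tp (?y k) + ?x k \<diamond> tp (?y h)) (gradient F M)
      + 2 * c * (inner R (tp (?x h) \<diamond> ?x k + tp (?x k) \<diamond> ?x h - (tp (?y h) \<diamond> ?y k + tp (?y k) \<diamond> ?y h))
        + inner (?dR (U, V) k) (?dR (U, V) h)))"
  have dL: "((\<lambda>q. ?x q \<diamond> tp (?y q)) has_derivative ?dL q) (at q)" for q
    by (auto intro!: derivative_eq_intros simp: add.commute)
  have dR: "(?R has_derivative ?dR q) (at q)" for q
    by (auto intro!: derivative_eq_intros simp: add.commute)
  have 1: "(\<phi> has_derivative D q) (at q)" for q
  proof -
    have *: "c * (inner a b + inner b a) = 2 * c * inner a b" for a b :: coords
      by (simp add: inner_commute)
    show ?thesis
      unfolding \<phi>_def D_def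
      using has_derivative_add[OF has_derivative_compose[OF dL[of q] gradient_has_derivative[OF F]]
          has_derivative_mult_right[OF has_derivative_inner[OF dR[of q] dR[of q]], of c]]
      by (simp only: *)
  qed
  have 2: "((\<lambda>q. D q h) has_derivative D2 h) (at (U, V))" for h
  proof -
    have dG: "((\<lambda>q. gradient F (?x q \<diamond> tp (?y q))) has_derivative (\<lambda>k. hessian F M (?dL (U, V) k))) (at (U, V))"
      using has_derivative_compose[OF dL[of "(U, V)"] hessian_has_derivative[OF F]] UV by (simp add: M_def)
    have d1: "((\<lambda>q. ?dL q h) has_derivative (\<lambda>k. ?x h \<diamond> tp (?y k) + ?x k \<diamond> tp (?y h))) (at (U, V))"
      by (auto intro!: derivative_eq_intros simp: mm.zero_left mm.zero_right)
    have d2: "((\<lambda>q. ?dR q h) has_derivative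
        (\<lambda>k. tp (?x h) \<diamond> ?x k + tp (?x k) \<diamond> ?x h - (tp (?y h) \<diamond> ?y k + tp (?y k) \<diamond> ?y h))) (at (U, V))"
      by (auto intro!: derivative_eq_intros simp: mm.zero_left mm.zero_right)
    have RUV: "?R (U, V) = R" "?x (U, V) \<diamond> tp (?y (U, V)) = M" using UV by (simp_all add: R_def M_def)
    show ?thesis
      unfolding D_def D2_def RUV[symmetric]
      by (rule has_derivative_eq_rhs, rule has_derivative_add[OF has_derivative_inner[OF d1 dG[unfolded RUV(2)[symmetric]]]
            has_derivative_mult_right[OF has_derivative_inner[OF dR d2]]]) (simp add: algebra_simps)
  qed
  let ?K1 = "{..<n} \<times> {..<r}" and ?K2 = "{..<m} \<times> {..<r}"
  \<comment> \<open>The unit vectors of both blocks; through the projections \<open>pr\<close> the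
    objective depends on these coordinates only.\<close>
  define e :: "(nat \<times> nat) + (nat \<times> nat) \<Rightarrow> coords \<times> coords"
    where "e = case_sum (\<lambda>k. (Poly_Mapping.single k 1, 0)) (\<lambda>k. (0, Poly_Mapping.single k 1))"
  have 3: "D q h = (\<Sum>i\<in>?K1 <+> ?K2. inner h (e i) * D q (e i))" for q h
  proof -
    have lin: "linear (D q)" using 1 has_derivative_linear by blast
    have "(pr n r (fst h), pr m r (snd h)) = (\<Sum>i\<in>?K1 <+> ?K2. inner h (e i) *\<^sub>R e i)"
      by (cases h) (simp add: sum.Plus e_def pr_expansion prod_eq_iff fst_sum snd_sum inner_Pair_0)
    moreover have "D q h = D q (pr n r (fst h), pr m r (snd h))" by (simp add: D_def)
    ultimately show ?thesis by (simp add: linear_sum[OF lin] linear_cmul[OF lin])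
  qed
  have "second_order_critical \<phi> (U, V)"
    using crit by (simp add: \<phi>_def power2_norm_eq_inner case_prod_unfold)
  note * = second_order_critical_directional[OF 1 2 3 this, of "(A, B)"]
  show "inner (gradient F M) L + 2 * c * inner R R1 = 0"
    using *(1) UV AB by (simp add: D_def L_def R_def R1_def M_def inner_commute)
  show "0 \<le> inner (hessian F M L) L + 2 * inner (gradient F M) (A \<diamond> tp B)
      + 2 * c * ((norm R1)\<^sup>2 + 2 * inner R (tp A \<diamond> A - tp B \<diamond> B))"
  proof -
    have "D2 (A, B) (A, B) = inner L (hessian F M L) + inner (A \<diamond> tp B + A \<diamond> tp B) (gradient F M)
        + 2 * c * (inner R (tp A \<diamond> A + tp A \<diamond> A - (tp B \<diamond> B + tp B \<diamond> B)) + inner R1 R1)"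
      using UV AB by (simp add: D2_def L_def R1_def)
    also have "\<dots> = inner (hessian F M L) L + 2 * inner (gradient F M) (A \<diamond> tp B)
      + 2 * c * ((norm R1)\<^sup>2 + 2 * inner R (tp A \<diamond> A - tp B \<diamond> B))"
      unfolding power2_norm_eq_inner
      by (simp only: inner_add_left inner_add_right inner_diff_right) (simp add: inner_commute algebra_simps)
    finally show ?thesis using *(2) by simp
  qed
qed

section \<open>Rank\<close>

text \<open>Each summand is an outer product of rank at most one, and rank is subadditive.\<close>

lemma rank_sum_products_le:
  fixes u v :: "nat \<Rightarrow> nat \<Rightarrow> real"
  shows "vec_space.rank n (mat n m (\<lambda>(i, j). \<Sum>k<r. u i k * v j k)) \<le> r"
proof (induction r)
  case 0
  have "mat n m (\<lambda>(i, j). \<Sum>k<0. u i k * v j k) = 0\<^sub>m n m" by (rule eq_matI) auto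
  then show ?case by (simp only: vec_space.rank_0I order_refl)
next
  case (Suc r)
  let ?A = "\<lambda>r. mat n m (\<lambda>(i, j). \<Sum>k<r. u i k * v j k)" and ?B = "mat n m (\<lambda>(i, j). u i r * v j r)"
  have "?A (Suc r) = ?A r + ?B" by (rule eq_matI) auto
  then have "vec_space.rank n (?A (Suc r)) \<le> vec_space.rank n (?A r) + vec_space.rank n ?B"
    using vec_space.rank_subadditive[of "?A r" n m ?B] by simp
  moreover have "vec_space.rank n ?B \<le> 1"
    by (rule vec_space.rank_le_1_product_entries[of _ _ m "\<lambda>i. u i r" "\<lambda>j. v j r"]) auto
  ultimately show ?case using Suc by simp
qed

lemma rank_mm_le:
  assumes "blk n r x"
  shows "vec_space.rank n (mat_of n m (x \<diamond> tp y)) \<le> r"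
proof -
  have "mat_of n m (x \<diamond> tp y)
      = mat n m (\<lambda>(i, j). \<Sum>k<r. Poly_Mapping.lookup x (i, k) * Poly_Mapping.lookup y (j, k))"
    by (rule eq_matI) (auto simp: mat_of_def lookup_mm[OF assms] lookup_tp)
  then show ?thesis by (simp only: rank_sum_products_le)
qed

text \<open>The shape of all points and directions in which the RIP is used.\<close>

lemma rank_two_factors_le:
  assumes "blk n r x" "blk n r z"
  shows "vec_space.rank n (mat_of n m (x \<diamond> tp y + z \<diamond> tp w)) \<le> 2 * r"
proof -
  have "mat_of n m (x \<diamond> tp y + z \<diamond> tp w) = mat_of n m (x \<diamond> tp y) + mat_of n m (z \<diamond> tp w)"
    by (rule eq_matI) (auto simp: mat_of_def lookup_add)
  then have "vec_space.rank n (mat_of n m (x \<diamond> tp y + z \<diamond> tp w))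
      \<le> vec_space.rank n (mat_of n m (x \<diamond> tp y)) + vec_space.rank n (mat_of n m (z \<diamond> tp w))"
    using vec_space.rank_subadditive[of "mat_of n m (x \<diamond> tp y)" n m "mat_of n m (z \<diamond> tp w)"] by simp
  then show ?thesis using rank_mm_le[OF assms(1), of m y] rank_mm_le[OF assms(2), of m w] by linarith
qed

text \<open>Enlarging a maximal independent set S of columns by any further column makes it
  dependent, so that column lies in the span of S.\<close>

lemma (in vec_space) column_basis:
  assumes A: "A \<in> carrier_mat n nc"
  obtains S a where "finite S" "card S = rank A"
    "\<And>i j. i < n \<Longrightarrow> j < nc \<Longrightarrow> A $$ (i, j) = (\<Sum>s\<in>S. a j s * vec_index s i)"
proof -
  let ?P = "\<lambda>T. T \<subseteq> set (cols A) \<and> lin_indpt T"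
  have "?P {}" using lin_dep_def by auto
  then obtain S where S: "finite S" "maximal S ?P"
    using maximal_exists_superset[of "set (cols A)" ?P "{}"] by auto
  have cV: "set (cols A) \<subseteq> carrier_vec n" using cols_dim A by blast
  have SP: "S \<subseteq> set (cols A)" "lin_indpt S" using S(2) by (auto simp: maximal_def)
  then have SV: "S \<subseteq> carrier_vec n" using cV by blast
  have "c \<in> span S" if c: "c \<in> set (cols A)" for c
  proof (cases "c \<in> S")
    case True
    then show ?thesis using span_mem SV by auto
  next
    case False
    have "lin_dep (S \<union> {c})"
    proof (rule ccontr)
      assume "lin_indpt (S \<union> {c})"
      then have "?P (S \<union> {c})" using SP c by auto
      then have "S \<union> {c} = S" using S(2) unfolding maximal_def by blast
      then show False using False by blast
    qed
    then show ?thesis using lin_dep_iff_in_span[of S c] SV SP(2) False c cV by auto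
  qed
  then have "\<forall>j\<in>{..<nc}. \<exists>b. col A j = lincomb b S"
    using finite_in_span[OF S(1)] SV A by (metis carrier_matD(2) cols_length cols_nth lessThan_iff nth_mem)
  then obtain a where a: "\<And>j. j < nc \<Longrightarrow> col A j = lincomb (a j) S" by (metis lessThan_iff)
  show ?thesis
  proof (rule that[of S a])
    show "card S = rank A" using rank_card_indpt[OF A S(2)] by simp
    fix i j assume "i < n" "j < nc"
    then have "A $$ (i, j) = vec_index (col A j) i" using A by simp
    also have "\<dots> = (\<Sum>s\<in>S. a j s * vec_index s i)"
      unfolding a[OF \<open>j < nc\<close>] using lincomb_index[OF \<open>i < n\<close> SV] .
    finally show "A $$ (i, j) = (\<Sum>s\<in>S. a j s * vec_index s i)" .
  qed (rule S(1))
qed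

lemma rank_factorization:
  assumes A: "A \<in> carrier_mat n m" and r: "vec_space.rank n A \<le> r"
  obtains z w where "blk n r z" "blk m r w" "coords_of A = z \<diamond> tp w"
proof -
  obtain S a where S: "finite S" "card S = vec_space.rank n A"
    "\<And>i j. i < n \<Longrightarrow> j < m \<Longrightarrow> A $$ (i, j) = (\<Sum>s\<in>S. a j s * vec_index s i)"
    using vec_space.column_basis[OF A] by metis
  let ?q = "card S"
  obtain h where h: "bij_betw h {..<?q} S"
    using ex_bij_betw_nat_finite[OF S(1)] by (auto simp: lessThan_atLeast0)
  \<comment> \<open>If the rank is smaller than r, both factors are padded with zero
    columns.\<close>
  let ?z = "coords_of (mat n r (\<lambda>(i, k). if k < ?q then vec_index (h k) i else 0))"
  let ?w = "coords_of (mat m r (\<lambda>(j, k). if k < ?q then a j (h k) else 0))"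
  have z: "blk n r ?z" and w: "blk m r ?w" by (auto intro!: blk_coords_of)
  have "coords_of A = ?z \<diamond> tp ?w"
  proof (rule blk_eqI[of n m])
    show "blk n m (coords_of A)" "blk n m (?z \<diamond> tp ?w)" using A z w by (auto intro!: blk_coords_of blk_mm blk_tp)
    fix i j assume ij: "i < n" "j < m"
    have "Poly_Mapping.lookup (?z \<diamond> tp ?w) (i, j)
        = (\<Sum>k<r. if k < ?q then vec_index (h k) i * a j (h k) else 0)"
      unfolding lookup_mm[OF z] using ij by (intro sum.cong) (auto simp: lookup_tp lookup_coords_of)
    also have "\<dots> = (\<Sum>k<?q. vec_index (h k) i * a j (h k))"
      using r S(2) by (intro sum.mono_neutral_cong_right) auto
    also have "\<dots> = (\<Sum>s\<in>S. vec_index s i * a j s)" by (rule sum.reindex_bij_betw[OF h])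
    also have "\<dots> = A $$ (i, j)" using S(3)[OF ij] by (simp add: mult.commute)
    finally show "Poly_Mapping.lookup (coords_of A) (i, j) = Poly_Mapping.lookup (?z \<diamond> tp ?w) (i, j)"
      using A ij by (simp add: lookup_coords_of)
  qed
  then show ?thesis using that z w by blast
qed

section \<open>Absence of spurious critical points\<close>

lemma frob_norm_coords: "A \<in> carrier_mat n m \<Longrightarrow> frob_norm A = norm (coords_of A)"
  by (simp add: frob_norm_def norm_eq_sqrt_inner inner_coords_of)

lemma inner_pr_blk: "blk n m w \<Longrightarrow> inner (pr n m x) w = inner x w"
  by (simp add: inner_pr)

definition coords_fun :: "nat \<Rightarrow> nat \<Rightarrow> (real mat \<Rightarrow> real) \<Rightarrow> coords \<Rightarrow> real" where
  "coords_fun n m f = f \<circ> mat_of n m"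

context
  fixes n m r :: nat and f :: "real mat \<Rightarrow> real" and \<delta> :: real and Ma :: "real mat"
  assumes smooth: "mat_twice_cont_diff n m f" and rip: "RIP n m r \<delta> f" and gt: "ground_truth n m r f Ma"
begin

abbreviation F where "F \<equiv> coords_fun n m f"

lemma F_smooth: "twice_cont_diff F"
  using smooth by (simp add: mat_twice_cont_diff_def coords_fun_def)

text \<open>The RIP in factored form: point and direction share the left factors x and z with r
  columns each, so both have rank at most 2r.\<close>

lemma hessian_bounds:
  assumes "blk n r x" "blk n r z" "blk m r a" "blk m r b" "blk m r c" "blk m r d"
    and "p = x \<diamond> tp a + z \<diamond> tp b" "k = x \<diamond> tp c + z \<diamond> tp d"
  shows "(1 - \<delta>) * (norm k)\<^sup>2 \<le> inner (hessian F p k) k" "inner (hessian F p k) k \<le> (1 + \<delta>) * (norm k)\<^sup>2"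
proof -
  have blk: "blk n m p" "blk n m k" using assms by (auto intro!: blk_intros)
  have "vec_space.rank n (mat_of n m p) \<le> 2 * r" "vec_space.rank n (mat_of n m k) \<le> 2 * r"
    using assms rank_two_factors_le by auto
  moreover have "frob_norm (mat_of n m k) = norm k"
    using blk by (simp add: frob_norm_coords[OF mat_of_carrier] coords_of_mat_of)
  moreover have "mat_hessian n m f (mat_of n m p) (mat_of n m k) (mat_of n m k) = inner (hessian F p k) k"
    using blk by (simp add: mat_hessian_def coords_of_mat_of coords_fun_def)
  ultimately show "(1 - \<delta>) * (norm k)\<^sup>2 \<le> inner (hessian F p k) k" "inner (hessian F p k) k \<le> (1 + \<delta>) * (norm k)\<^sup>2"
    using rip mat_of_carrier[of n m p] mat_of_carrier[of n m k] unfolding RIP_def by metis+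
qed

lemma ground_truth_gradient: "blk n m w \<Longrightarrow> inner (gradient F (coords_of Ma)) w = 0"
proof -
  assume w: "blk n m w"
  have "pr n m (gradient F (coords_of Ma)) = coords_of (0\<^sub>m n m)"
    using gt by (simp add: ground_truth_def mat_gradient_def pr_def coords_fun_def)
  also have "\<dots> = 0" by (rule coords_eqI) (auto simp: lookup_coords_of when_def)
  finally show ?thesis using inner_pr_blk[OF w] by (metis inner_zero_left)
qed

text \<open>The segment from \<open>Ma\<close> to U V^T stays among matrices with the left factors z
  and U. There the RIP with \<delta> < 1 makes the Hessian nonnegative in the direction of the
  segment, and \<open>Ma\<close> is critical.\<close>

lemma ground_truth_minimal:
  assumes "U \<in> carrier_mat n r" "V \<in> carrier_mat m r"
  shows "f Ma \<le> f (U * transpose_mat V)"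
proof -
  have Ma: "Ma \<in> carrier_mat n m" using gt by (simp add: ground_truth_def)
  obtain z w where zw: "blk n r z" "blk m r w" "coords_of Ma = z \<diamond> tp w"
    using rank_factorization[of Ma n m r] gt unfolding ground_truth_def by blast
  let ?u = "coords_of U" and ?v = "coords_of V"
  have uv: "blk n r ?u" "blk m r ?v" using assms by (auto intro: blk_coords_of)
  have UV: "U * transpose_mat V \<in> carrier_mat n m" using assms by (auto intro!: mult_carrier_mat)
  have cUV: "coords_of (U * transpose_mat V) = ?u \<diamond> tp ?v"
    using assms coords_of_mult[of U n r "transpose_mat V" m] by (simp add: coords_of_transpose)
  define e where "e = ?u \<diamond> tp ?v - z \<diamond> tp w"
  have "F (z \<diamond> tp w) \<le> F (z \<diamond> tp w + e)"
  proof (rule critical_point_minimal_on_segment[OF F_smooth])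
    have "blk n m e" using uv zw by (auto simp: e_def intro!: blk_intros)
    then show "inner (gradient F (z \<diamond> tp w)) e = 0" using ground_truth_gradient zw(3) by simp
    fix t :: real
    have "z \<diamond> tp w + t *\<^sub>R e = z \<diamond> tp ((1 - t) *\<^sub>R w) + ?u \<diamond> tp (t *\<^sub>R ?v)"
      by (simp add: e_def mm_simps scaleR_diff_left scaleR_diff_right)
    moreover have "e = z \<diamond> tp (- w) + ?u \<diamond> tp ?v" by (simp add: e_def tp_minus mm_simps)
    ultimately have "(1 - \<delta>) * (norm e)\<^sup>2 \<le> inner (hessian F (z \<diamond> tp w + t *\<^sub>R e) e) e"
      by (intro hessian_bounds(1)[of z ?u]) (use zw uv in \<open>auto intro!: blk_intros\<close>)
    moreover have "0 \<le> (1 - \<delta>) * (norm e)\<^sup>2" using rip by (simp add: RIP_def)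
    ultimately show "0 \<le> inner (hessian F (z \<diamond> tp w + t *\<^sub>R e) e) e" by linarith
  qed
  then show ?thesis
    using mat_of_coords_of[OF Ma] mat_of_coords_of[OF UV] by (simp add: e_def cUV zw(3) coords_fun_def)
qed

text \<open>The regularizer is eliminated first, by showing that c or R is zero. What remains are
  the conditions of the factorized problem, to which \<open>critical_point_unique\<close>
  applies.\<close>

lemma second_order_critical_eq_ground_truth:
  assumes \<delta>: "\<delta> < 1/2" and c: "0 \<le> c" and U: "U \<in> carrier_mat n r" and V: "V \<in> carrier_mat m r"
    and crit: "second_order_critical (\<lambda>(x, y). F (pr n r x \<diamond> tp (pr m r y)) +
        c * (norm (tp (pr n r x) \<diamond> pr n r x - tp (pr m r y) \<diamond> pr m r y))\<^sup>2) (coords_of U, coords_of V)"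
  shows "U * transpose_mat V = Ma" "0 < c \<Longrightarrow> transpose_mat U * U = transpose_mat V * V"
proof -
  have \<delta>0: "0 \<le> \<delta>" using rip by (simp add: RIP_def)
  have Ma: "Ma \<in> carrier_mat n m" using gt by (simp add: ground_truth_def)
  obtain z w where zw: "blk n r z" "blk m r w" "coords_of Ma = z \<diamond> tp w"
    using rank_factorization[of Ma n m r] gt unfolding ground_truth_def by blast
  define u where "u = coords_of U"
  define v where "v = coords_of V"
  have uv: "blk n r u" "blk m r v" using U V by (auto simp: u_def v_def intro: blk_coords_of)
  define M where "M = u \<diamond> tp v"
  define R where "R = tp u \<diamond> u - tp v \<diamond> v"
  have R: "blk r r R" "tp R = R" using uv by (auto simp: R_def tp_mm tp_diff intro!: blk_intros)
  note soc = second_order_conditions[OF F_smooth uv crit[folded u_def v_def], folded M_def R_def]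
  have cR: "c = 0 \<or> R = 0"
  proof (rule ccontr)
    assume "\<not> (c = 0 \<or> R = 0)"
    then have "0 < c" "R \<noteq> 0" using c by auto
    \<comment> \<open>Along (u R, - v R) the first variation of u v^T is zero, so only the
      regularizer contributes, and it forces u R = v R = 0. Then |R|^2 = <u, u R> - <v, v R>
      vanishes.\<close>
    have blks: "blk n r (u \<diamond> R)" "blk m r (- (v \<diamond> R))" using uv R by (auto intro!: blk_intros)
    have "(u \<diamond> R) \<diamond> tp v + u \<diamond> tp (- (v \<diamond> R)) = 0" by (simp add: tp_minus mm_simps R)
    then have "inner R (tp (u \<diamond> R) \<diamond> u + tp u \<diamond> (u \<diamond> R) - (tp (- (v \<diamond> R)) \<diamond> v + tp v \<diamond> - (v \<diamond> R))) = 0"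
      using soc(1)[OF blks] \<open>0 < c\<close> by simp
    moreover have "inner R (tp x \<diamond> (x \<diamond> R)) = (norm (x \<diamond> R))\<^sup>2" "inner R (R \<diamond> (tp x \<diamond> x)) = (norm (x \<diamond> R))\<^sup>2" for x
    proof -
      show 1: "inner R (tp x \<diamond> (x \<diamond> R)) = (norm (x \<diamond> R))\<^sup>2"
        unfolding power2_norm_eq_inner by (simp add: inner_mm_left)
      have "inner R (R \<diamond> (tp x \<diamond> x)) = inner (tp R) (R \<diamond> (tp x \<diamond> x))" by (simp add: R)
      also have "\<dots> = inner R (tp (R \<diamond> (tp x \<diamond> x)))" by (rule inner_tp)
      also have "\<dots> = inner R (tp x \<diamond> (x \<diamond> R))" by (simp add: tp_mm mm_assoc R)
      finally show "inner R (R \<diamond> (tp x \<diamond> x)) = (norm (x \<diamond> R))\<^sup>2" using 1 by simp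
    qed
    ultimately have "2 * (norm (u \<diamond> R))\<^sup>2 + 2 * (norm (v \<diamond> R))\<^sup>2 = 0"
      by (simp add: tp_minus tp_mm R mm.minus_left mm.minus_right mm_assoc inner_add_right inner_diff_right)
    then have "(norm (u \<diamond> R))\<^sup>2 = 0" "(norm (v \<diamond> R))\<^sup>2 = 0"
      using zero_le_power2[of "norm (u \<diamond> R)"] zero_le_power2[of "norm (v \<diamond> R)"] by linarith+
    then have uR: "u \<diamond> R = 0" "v \<diamond> R = 0" by simp_all
    have "inner (tp x \<diamond> x) R = inner x (x \<diamond> R)" for x by (simp add: inner_mm_left)
    then have "inner R R = 0" by (simp add: R_def inner_diff_left) (simp add: R_def[symmetric] uR)
    then show False using \<open>R \<noteq> 0\<close> by simp
  qed
  then have cR': "c * inner R x = 0" for x by auto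
  define G where "G = pr n m (gradient F M)"
  have G: "blk n m G" by (simp add: G_def)
  have Ginner: "inner G x = inner (gradient F M) x" if "blk n m x" for x
    unfolding G_def using inner_pr_blk[OF that] .
  have first: "inner G (A \<diamond> tp v + u \<diamond> tp B) = 0" if "blk n r A" "blk m r B" for A B
  proof -
    have "blk n m (A \<diamond> tp v + u \<diamond> tp B)" using that uv by (auto intro!: blk_intros)
    then show ?thesis using soc(1)[OF that] cR' Ginner by (simp add: mult.assoc)
  qed
  \<comment> \<open>The directions (G v, 0) and (0, G^T u) turn the first-order condition into |G
    v|^2 = 0 and |u^T G|^2 = 0.\<close>
  have "inner G ((G \<diamond> v) \<diamond> tp v) = 0"
    using first[of "G \<diamond> v" 0] G uv by (auto simp: mm.zero_right intro!: blk_intros)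
  then have Gv: "G \<diamond> v = 0" by (simp add: inner_mm_right[symmetric])
  have "inner G (u \<diamond> tp (tp G \<diamond> u)) = 0"
    using first[of 0 "tp G \<diamond> u"] G uv by (auto simp: mm.zero_left intro!: blk_intros)
  then have "inner (u \<diamond> (tp u \<diamond> G)) G = 0" by (simp add: tp_mm inner_commute)
  then have "inner (tp u \<diamond> G) (tp u \<diamond> G) = 0" by (simp only: inner_mm_left)
  then have uG: "tp u \<diamond> G = 0" by simp
  have "z \<diamond> tp w = u \<diamond> tp v"
  proof (rule critical_point_unique[OF \<delta>0 \<delta> uv G zw(1,2) Gv uG])
    fix A B assume AB: "blk n r A" "blk m r B" and orth: "tp u \<diamond> A = 0" "tp v \<diamond> B = 0"
    \<comment> \<open>In normal directions the imbalance is constant to first order, so the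
      regularizer drops out of the second-order condition as well.\<close>
    have R1: "tp A \<diamond> u + tp u \<diamond> A - (tp B \<diamond> v + tp v \<diamond> B) = 0"
      using orth by (metis add_0 diff_0_right tp_mm tp_tp tp_zero)
    let ?L = "A \<diamond> tp v + u \<diamond> tp B"
    have "inner (hessian F M ?L) ?L \<le> (1 + \<delta>) * (norm ?L)\<^sup>2"
      by (rule hessian_bounds(2)[of u A v 0 B v]) (use AB uv in \<open>auto simp: M_def mm.zero_right add.commute\<close>)
    moreover have "0 \<le> inner (hessian F M ?L) ?L + 2 * inner (gradient F M) (A \<diamond> tp B)"
      using soc(2)[OF AB] cR' unfolding R1 by (simp add: distrib_left mult.left_commute)
    moreover have "inner G (A \<diamond> tp B) = inner (gradient F M) (A \<diamond> tp B)"
      using AB by (intro Ginner) (auto intro!: blk_intros)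
    ultimately show "0 \<le> (1 + \<delta>) * (norm (u \<diamond> tp B + A \<diamond> tp v))\<^sup>2 + 2 * inner G (A \<diamond> tp B)"
      by (simp add: add.commute)
  next
    fix a b assume ab: "blk m r a" "blk m r b"
    let ?e = "z \<diamond> tp w - u \<diamond> tp v" and ?k = "u \<diamond> tp a + z \<diamond> tp b"
    have k: "blk n m ?k" using ab uv zw by (auto intro!: blk_intros)
    have abs_bound: "(1 - \<delta>) * q \<le> h \<Longrightarrow> h \<le> (1 + \<delta>) * q \<Longrightarrow> \<bar>h - q\<bar> \<le> \<delta> * q" for h q
      by (simp add: abs_le_iff algebra_simps)
    have "\<bar>inner (gradient F M) ?k + inner ?e ?k\<bar> \<le> \<delta> * norm ?e * norm ?k"
    proof (rule gradient_difference_rip[OF F_smooth])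
      show "inner (gradient F (M + ?e)) ?k = 0"
        using ground_truth_gradient[OF k] by (simp add: M_def zw(3))
      fix t \<alpha> \<beta> :: real
      let ?d = "\<alpha> *\<^sub>R ?e + \<beta> *\<^sub>R ?k"
      \<comment> \<open>Every point of the segment and every combination of \<open>?e\<close> and
        \<open>?k\<close> keeps the left factors u and z.\<close>
      have p: "M + t *\<^sub>R ?e = u \<diamond> tp ((1 - t) *\<^sub>R v) + z \<diamond> tp (t *\<^sub>R w)"
        by (simp add: M_def mm_simps scaleR_diff_left scaleR_diff_right)
      have d: "?d = u \<diamond> tp (\<beta> *\<^sub>R a - \<alpha> *\<^sub>R v) + z \<diamond> tp (\<alpha> *\<^sub>R w + \<beta> *\<^sub>R b)"
        by (simp add: mm_simps scaleR_diff_right scaleR_add_right)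
      have "blk m r ((1 - t) *\<^sub>R v)" "blk m r (t *\<^sub>R w)" "blk m r (\<beta> *\<^sub>R a - \<alpha> *\<^sub>R v)"
        "blk m r (\<alpha> *\<^sub>R w + \<beta> *\<^sub>R b)" using ab uv zw by (auto intro!: blk_intros)
      note hessian_bounds[OF uv(1) zw(1) this p d]
      then show "\<bar>inner (hessian F (M + t *\<^sub>R ?e) ?d) ?d - (norm ?d)\<^sup>2\<bar> \<le> \<delta> * (norm ?d)\<^sup>2"
        by (rule abs_bound)
    qed
    then show "\<bar>inner G ?k + inner ?e ?k\<bar> \<le> \<delta> * norm ?e * norm ?k" using Ginner[OF k] by simp
  qed
  moreover have "coords_of (U * transpose_mat V) = u \<diamond> tp v"
    using U V coords_of_mult[of U n r "transpose_mat V" m] by (simp add: coords_of_transpose u_def v_def)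
  ultimately have "coords_of (U * transpose_mat V) = coords_of Ma" by (simp add: zw(3))
  moreover have "U * transpose_mat V \<in> carrier_mat n m" using U V by (auto intro!: mult_carrier_mat)
  ultimately show "U * transpose_mat V = Ma" using Ma by (metis mat_of_coords_of)
  assume "0 < c"
  then have "tp u \<diamond> u = tp v \<diamond> v" using cR by (simp add: R_def)
  then have "coords_of (transpose_mat U * U) = coords_of (transpose_mat V * V)"
    using U V coords_of_mult[of "transpose_mat U" r n U r] coords_of_mult[of "transpose_mat V" r m V r]
    by (simp add: coords_of_transpose u_def v_def)
  moreover have "transpose_mat U * U \<in> carrier_mat r r" "transpose_mat V * V \<in> carrier_mat r r"
    using U V by (auto intro!: mult_carrier_mat)
  ultimately show "transpose_mat U * U = transpose_mat V * V" by (metis mat_of_coords_of)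
qed

section \<open>The two objectives in coordinates and their critical points\<close>

lemma factorized_coords: "factorized f (mat_of n r x) (mat_of m r y) = F (pr n r x \<diamond> tp (pr m r y))"
proof -
  have "pr n r x \<diamond> tp (pr m r y) = coords_of (mat_of n r x * transpose_mat (mat_of m r y))"
    unfolding pr_def by (simp add: coords_of_mult[of _ n r _ m] coords_of_transpose)
  moreover have "mat_of n r x * transpose_mat (mat_of m r y) \<in> carrier_mat n m"
    by (rule mult_carrier_mat[of _ n r]) simp_all
  ultimately show ?thesis by (simp add: factorized_def mat_of_coords_of coords_fun_def)
qed

lemma regularized_coords: "regularized f \<mu> (mat_of n r x) (mat_of m r y) = F (pr n r x \<diamond> tp (pr m r y)) +
    \<mu> / 4 * (norm (tp (pr n r x) \<diamond> pr n r x - tp (pr m r y) \<diamond> pr m r y))\<^sup>2"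
proof -
  let ?X = "mat_of n r x" and ?Y = "mat_of m r y"
  have X: "transpose_mat ?X * ?X \<in> carrier_mat r r"
    by (rule mult_carrier_mat[of _ r n]) simp_all
  have Y: "transpose_mat ?Y * ?Y \<in> carrier_mat r r"
    by (rule mult_carrier_mat[of _ r m]) simp_all
  have "coords_of (transpose_mat ?X * ?X - transpose_mat ?Y * ?Y)
      = tp (pr n r x) \<diamond> pr n r x - tp (pr m r y) \<diamond> pr m r y"
    unfolding pr_def using coords_of_minus[OF X Y] coords_of_mult[of "transpose_mat ?X" r n ?X r]
      coords_of_mult[of "transpose_mat ?Y" r m ?Y r] by (simp add: coords_of_transpose)
  moreover have "transpose_mat ?X * ?X - transpose_mat ?Y * ?Y \<in> carrier_mat r r"
    using Y by (rule minus_carrier_mat)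
  ultimately show ?thesis
    using factorized_coords[of x y] by (simp add: regularized_def factorized_def frob_norm_coords)
qed

lemma factorized_critical:
  assumes "\<delta> < 1/2" "pair_second_order_critical n m r (factorized f) U V"
  shows "U * transpose_mat V = Ma"
  using assms second_order_critical_eq_ground_truth(1)[of 0 U V]
  by (simp add: pair_second_order_critical_def factorized_coords)

lemma regularized_critical:
  assumes "\<delta> < 1/2" "0 < \<mu>" "pair_second_order_critical n m r (regularized f \<mu>) U V"
  shows "U * transpose_mat V = Ma" "transpose_mat U * U = transpose_mat V * V"
  using assms second_order_critical_eq_ground_truth[of "\<mu> / 4" U V]
  by (simp_all add: pair_second_order_critical_def regularized_coords)

lemma factorized_not_spurious:
  assumes "\<delta> < 1/2"
  shows "\<not> pair_spurious n m r (factorized f) U V"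
  using factorized_critical[OF assms, of U V] ground_truth_minimal
  by (auto simp: pair_spurious_def pair_global_minimizer_def factorized_def pair_second_order_critical_def)

text \<open>At a critical point the product is \<open>Ma\<close> and the factors are balanced, so
  the penalty is zero; elsewhere it is nonnegative, and \<open>f Ma\<close> is minimal among all
  products.\<close>

lemma regularized_not_spurious:
  assumes "\<delta> < 1/2" "0 < \<mu>"
  shows "\<not> pair_spurious n m r (regularized f \<mu>) U V"
proof
  assume "pair_spurious n m r (regularized f \<mu>) U V"
  then have crit: "pair_second_order_critical n m r (regularized f \<mu>) U V"
    and no_min: "\<not> pair_global_minimizer n m r (regularized f \<mu>) U V" by (auto simp: pair_spurious_def)
  have V: "U \<in> carrier_mat n r" "V \<in> carrier_mat m r" using crit by (auto simp: pair_second_order_critical_def)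
  note eq = regularized_critical[OF assms crit]
  have "frob_norm (transpose_mat V * V - transpose_mat V * V) = 0"
  proof -
    have VV: "transpose_mat V * V \<in> carrier_mat r r" using V by (auto intro!: mult_carrier_mat)
    then have "transpose_mat V * V - transpose_mat V * V \<in> carrier_mat r r" by (simp add: minus_carrier_mat)
    then show ?thesis using coords_of_minus[OF VV VV] by (simp add: frob_norm_coords)
  qed
  then have "regularized f \<mu> U V = f Ma" by (simp add: regularized_def eq)
  moreover have "f Ma \<le> regularized f \<mu> U' V'" if "U' \<in> carrier_mat n r" "V' \<in> carrier_mat m r" for U' V'
  proof -
    have "0 \<le> \<mu> / 4 * (frob_norm (transpose_mat U' * U' - transpose_mat V' * V'))\<^sup>2" using assms(2) by simp
    then show ?thesis using ground_truth_minimal[OF that] by (simp add: regularized_def)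
  qed
  ultimately show False using no_min V by (simp add: pair_global_minimizer_def)
qed

end

theorem corollary2:
  shows "(\<forall>(n::nat) (m::nat) (r::nat) (f\<^sub>a :: real mat \<Rightarrow> real) (M\<^sub>a :: real mat) (\<delta>::real).
        mat_twice_cont_diff n m f\<^sub>a \<longrightarrow> ground_truth n m r f\<^sub>a M\<^sub>a \<longrightarrow> RIP n m r \<delta> f\<^sub>a \<longrightarrow>
        \<delta> \<le> 1/3 \<longrightarrow>
          (\<nexists>U V. pair_spurious n m r (factorized f\<^sub>a) U V) \<and>
          (\<forall>\<mu>>0. \<nexists>U V. pair_spurious n m r (regularized f\<^sub>a \<mu>) U V))
    \<and> (\<exists>C :: real \<Rightarrow> real. C \<in> {0..<1/2} \<rightarrow> {0<..1} \<and>
        (\<forall>(n::nat) (m::nat) (r::nat) (f\<^sub>a :: real mat \<Rightarrow> real) (M\<^sub>a :: real mat).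
         \<forall>\<delta>\<in>{0..<1/2}.
          mat_twice_cont_diff n m f\<^sub>a \<longrightarrow> ground_truth n m r f\<^sub>a M\<^sub>a \<longrightarrow> RIP n m r \<delta> f\<^sub>a \<longrightarrow>
            (\<forall>U V. pair_second_order_critical n m r (factorized f\<^sub>a) U V \<or>
                (\<exists>\<mu>>0. pair_second_order_critical n m r (regularized f\<^sub>a \<mu>) U V) \<longrightarrow>
              frob_inner (U * transpose_mat V) M\<^sub>a
                \<ge> C \<delta> * frob_norm (U * transpose_mat V) * frob_norm M\<^sub>a)))"
    (is "?spurious \<and> ?correlated")
proof
  have "\<delta> < 1/2" if "\<delta> \<le> 1/3" for \<delta> :: real using that by simp
  then show ?spurious
    by (intro allI impI conjI notI; elim exE)
      (use factorized_not_spurious regularized_not_spurious in blast)+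
  show ?correlated
  \<comment> \<open>The constant 1 works because the product equals the ground truth, where
    Cauchy-Schwarz is an equality.\<close>
  proof (intro exI[of _ "\<lambda>_. 1"] conjI allI ballI impI)
    show "(\<lambda>_. 1) \<in> {0..<1/2} \<rightarrow> {0<..1 :: real}" by simp
    fix n m r f\<^sub>a M\<^sub>a \<delta> U V
    assume \<delta>: "\<delta> \<in> {0..<1/2 :: real}" and *: "mat_twice_cont_diff n m f\<^sub>a" "RIP n m r \<delta> f\<^sub>a" "ground_truth n m r f\<^sub>a M\<^sub>a"
      and crit: "pair_second_order_critical n m r (factorized f\<^sub>a) U V \<or>
        (\<exists>\<mu>>0. pair_second_order_critical n m r (regularized f\<^sub>a \<mu>) U V)"
    have M: "M\<^sub>a \<in> carrier_mat n m" using *(3) by (simp add: ground_truth_def)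
    have "U * transpose_mat V = M\<^sub>a"
      using crit factorized_critical[OF *, of U V] regularized_critical(1)[OF *, of _ U V] \<delta> by auto
    moreover have "frob_inner M\<^sub>a M\<^sub>a = frob_norm M\<^sub>a * frob_norm M\<^sub>a"
      using M by (simp add: frob_norm_coords inner_coords_of[OF M M, symmetric] power2_norm_eq_inner[symmetric] power2_eq_square)
    ultimately show "1 * frob_norm (U * transpose_mat V) * frob_norm M\<^sub>a \<le> frob_inner (U * transpose_mat V) M\<^sub>a"
      by simp
  qed
qed

end
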